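(* Let $(H,\Lambda)$ be a compatible pair and let $P_o\subset\Lambda$ be a measured subset of $G$. Then for every $G$-invariant Borel probability measure $\mu_{P_o}$ on the hull $X(P_o)$, the $(G,H)$-transverse system $(X(P_o),Y(P_o),\mu_{P_o})$ is integrable, i.e. $$\int_{X(P_o)}|Y(P_o)_P\cap L|\,d\mu_{P_o}(P)<\infty\quad\text{for every compact }L\subset H\backslash G,$$ where $Y(P_o)_P=\{Hg\in H\backslash G\mid g.P\in Y(P_o)\}$.
   Context: $G$ is a unimodular lcsc group, $H<G$ a closed unimodular subgroup. The space $\mathcal C(G)$ of closed subsets of $G$ carries the (compact metrizable) Chabauty–Fell topology and $G$ acts on it by $g.P=Pg^{-1}$. For $P_o\in\mathcal C(G)$ let $X^+(P_o)$ be the closure of its $G$-orbit in $\mathcal C(G)$; the hull is $X(P_o)=X^+(P_o)\setminus\{\emptyset\}$, and $Y(P_o)=\{P\in X(P_o)\mid P\cap H\neq\emptyset\}$. A uniformly discrete set $P_o\subset G$ (i.e. $e_G$ is not an accumulation point of $P_oP_o^{-1}$) is measured if $X(P_o)$ admits a $G$-invariant Borel probability measure. Let $\Lambda\subset G$ be symmetric and contain the identity. $\Lambda$ has finite covolume if $G=\Lambda\mathcal F$ for some $\mathcal F\subset G$ of finite Haar measure; $\Lambda$ is an approximate subgroup if $\Lambda\Lambda\subset\Lambda F$ for some finite $F\subset G$. An approximate lattice is a discrete approximate subgroup of finite covolume. $(H,\Lambda)$ is a compatible pair if $\Lambda\subset G$ and $\Lambda\cap H\subset H$ are both approximate lattices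 (in $G$ and $H$, respectively). *)

theory Defs
  imports "HOL-Analysis.Analysis" "HOL-Probability.Probability_Measure"
begin

text \<open>
  Groups are written additively but are not assumed to be commutative: the ambient group \<open>G\<close> is a
  type of class \<^class>\<open>topological_group_add\<close>, so that \<open>g h\<close>, \<open>g h\<inverse>\<close> and the unit of \<open>G\<close> are
  rendered as \<open>g + h\<close>, \<open>g - h\<close> and \<open>0\<close>, and a product set \<open>A B\<close> is the set sum \<open>A + B\<close>.
  Notions that are needed both for \<open>G\<close> and for the closed subgroup \<open>H\<close> take the subgroup as a
  parameter \<open>K\<close>; \<open>G\<close> itself is \<^term>\<open>UNIV\<close>.
\<close>

definition closed_subgroup :: "'a::topological_group_add set \<Rightarrow> bool" where
  "closed_subgroup K \<longleftrightarrow>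
     closed K \<and> 0 \<in> K \<and> (\<forall>x\<in>K. \<forall>y\<in>K. x + y \<in> K) \<and> (\<forall>x\<in>K. - x \<in> K)"


subsection \<open>Haar measures and unimodularity\<close>

text \<open>
  On a second countable locally compact Hausdorff space, every Borel measure that is finite on
  compact sets is regular, so regularity is not listed as a separate condition.
\<close>

definition left_haar_measure :: "'a::topological_group_add set \<Rightarrow> 'a measure \<Rightarrow> bool" where
  "left_haar_measure K m \<longleftrightarrow>
     sets m = sets (restrict_space borel K) \<and>
     emeasure m K \<noteq> 0 \<and>
     (\<forall>C. compact C \<and> C \<subseteq> K \<longrightarrow> emeasure m C < \<infinity>) \<and>
     (\<forall>k\<in>K. \<forall>A\<in>sets m. emeasure m ((\<lambda>x. k + x) ` A) = emeasure m A)"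

definition right_invariant :: "'a::topological_group_add set \<Rightarrow> 'a measure \<Rightarrow> bool" where
  "right_invariant K m \<longleftrightarrow>
     (\<forall>k\<in>K. \<forall>A\<in>sets m. emeasure m ((\<lambda>x. x + k) ` A) = emeasure m A)"

definition unimodular :: "'a::topological_group_add set \<Rightarrow> bool" where
  "unimodular K \<longleftrightarrow> (\<exists>m. left_haar_measure K m \<and> right_invariant K m)"


subsection \<open>Approximate lattices\<close>

definition approximate_subgroup ::
  "'a::topological_group_add set \<Rightarrow> 'a set \<Rightarrow> bool" where
  "approximate_subgroup K \<Lambda> \<longleftrightarrow>
     \<Lambda> \<subseteq> K \<and> 0 \<in> \<Lambda> \<and> (\<forall>x\<in>\<Lambda>. - x \<in> \<Lambda>) \<and>
     (\<exists>F. finite F \<and> F \<subseteq> K \<and> \<Lambda> + \<Lambda> \<subseteq> \<Lambda> + F)"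

text \<open>
  Haar measures are unique up to a positive factor, so \<open>F\<close> has finite measure for one of them
  if and only if it has finite measure for all of them.
\<close>

definition finite_covolume :: "'a::topological_group_add set \<Rightarrow> 'a set \<Rightarrow> bool" where
  "finite_covolume K \<Lambda> \<longleftrightarrow>
     (\<exists>F. F \<in> sets (restrict_space borel K) \<and> K = \<Lambda> + F \<and>
          (\<forall>m. left_haar_measure K m \<longrightarrow> emeasure m F < \<infinity>))"

definition approximate_lattice :: "'a::topological_group_add set \<Rightarrow> 'a set \<Rightarrow> bool" where
  "approximate_lattice K \<Lambda> \<longleftrightarrow>
     discrete \<Lambda> \<and> approximate_subgroup K \<Lambda> \<and> finite_covolume K \<Lambda>"

definition compatible_pair :: "'a::topological_group_add set \<Rightarrow> 'a set \<Rightarrow> bool" where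
  "compatible_pair H \<Lambda> \<longleftrightarrow>
     approximate_lattice UNIV \<Lambda> \<and> approximate_lattice H (\<Lambda> \<inter> H)"


subsection \<open>The Chabauty--Fell topology and hulls\<close>

text \<open>Taking \<open>C = {}\<close> shows that the underlying set consists of all closed sets.\<close>

definition chabauty_fell :: "'a::topological_space set topology" where
  "chabauty_fell = topology_generated_by
     ({{P. closed P \<and> P \<inter> C = {}} | C. compact C} \<union>
      {{P. closed P \<and> P \<inter> U \<noteq> {}} | U. open U})"

definition act :: "'a::group_add \<Rightarrow> 'a set \<Rightarrow> 'a set" where
  "act g P = (\<lambda>p. p - g) ` P"

definition extended_orbit_hull :: "'a::topological_group_add set \<Rightarrow> 'a set set" where
  "extended_orbit_hull P\<^sub>o = chabauty_fell closure_of (range (\<lambda>g. act g P\<^sub>o))"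

definition orbit_hull :: "'a::topological_group_add set \<Rightarrow> 'a set set" where
  "orbit_hull P\<^sub>o = extended_orbit_hull P\<^sub>o - {{}}"

definition hull_transversal ::
  "'a::topological_group_add set \<Rightarrow> 'a set \<Rightarrow> 'a set set" where
  "hull_transversal H P\<^sub>o = {P \<in> orbit_hull P\<^sub>o. P \<inter> H \<noteq> {}}"

definition borel_of_topology :: "'b topology \<Rightarrow> 'b measure" where
  "borel_of_topology T = sigma (topspace T) {U. openin T U}"

definition invariant_hull_measure ::
  "'a::topological_group_add set \<Rightarrow> 'a set measure \<Rightarrow> bool" where
  "invariant_hull_measure P\<^sub>o \<mu> \<longleftrightarrow>
     prob_space \<mu> \<and>
     sets \<mu> = sets (borel_of_topology (subtopology chabauty_fell (orbit_hull P\<^sub>o))) \<and>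
     (\<forall>g. \<forall>A\<in>sets \<mu>. emeasure \<mu> (act g ` A) = emeasure \<mu> A)"

definition uniformly_discrete :: "'a::topological_group_add set \<Rightarrow> bool" where
  "uniformly_discrete P \<longleftrightarrow> \<not> 0 islimpt {p - q | p q. p \<in> P \<and> q \<in> P}"

definition measured :: "'a::topological_group_add set \<Rightarrow> bool" where
  "measured P\<^sub>o \<longleftrightarrow> uniformly_discrete P\<^sub>o \<and> (\<exists>\<mu>. invariant_hull_measure P\<^sub>o \<mu>)"


subsection \<open>Right cosets and integrability of transverse systems\<close>

definition right_coset :: "'a::group_add set \<Rightarrow> 'a \<Rightarrow> 'a set" where
  "right_coset H g = (\<lambda>h. h + g) ` H"

text \<open>The space \<open>H\G\<close> of right cosets with the quotient topology.\<close>

definition right_coset_space :: "'a::topological_group_add set \<Rightarrow> 'a set topology" where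
  "right_coset_space H =
     topology (\<lambda>U. U \<subseteq> range (right_coset H) \<and> open (right_coset H -` U))"

lemma openin_right_coset_space:
  "openin (right_coset_space H) U \<longleftrightarrow>
     U \<subseteq> range (right_coset H) \<and> open (right_coset H -` U)"
proof -
  have "istopology (\<lambda>U. U \<subseteq> range (right_coset H) \<and> open (right_coset H -` U))"
    unfolding istopology_def by (auto simp: vimage_Union)
  then show ?thesis
    unfolding right_coset_space_def by (simp add: topology_inverse')
qed

lemma topspace_right_coset_space: "topspace (right_coset_space H) = range (right_coset H)"
proof
  show "topspace (right_coset_space H) \<subseteq> range (right_coset H)"
    using openin_topspace[of "right_coset_space H"] unfolding openin_right_coset_space by blast
  have "right_coset H -` range (right_coset H) = UNIV"
    by blast
  then have "openin (right_coset_space H) (range (right_coset H))"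
    unfolding openin_right_coset_space by simp
  then show "range (right_coset H) \<subseteq> topspace (right_coset_space H)"
    by (rule openin_subset)
qed

definition return_set :: "'a::group_add set \<Rightarrow> 'a set set \<Rightarrow> 'a set \<Rightarrow> 'a set set" where
  "return_set H Y P = {right_coset H g | g. act g P \<in> Y}"

text \<open>
  \<^const>\<open>nn_integral\<close> is a lower integral on non-measurable functions; measurability is
  required so that the integral is the intended one.
\<close>

definition integrable_transverse_system ::
  "'a::topological_group_add set \<Rightarrow> 'a set set \<Rightarrow> 'a set measure \<Rightarrow> bool" where
  "integrable_transverse_system H Y \<mu> \<longleftrightarrow>
     (\<forall>L. compactin (right_coset_space H) L \<longrightarrow>
        (\<lambda>P. emeasure (count_space UNIV) (return_set H Y P \<inter> L)) \<in> borel_measurable \<mu> \<and>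
        (\<integral>\<^sup>+ P. emeasure (count_space UNIV) (return_set H Y P \<inter> L) \<partial>\<mu>) < \<infinity>)"

end

theory Submission
  imports Defs
begin

text \<open>
  For \<open>P\<close> in the hull, \<open>Y(P\<^sub>o)\<^sub>P\<close> is the image of \<open>P\<close> in \<open>H\G\<close>. Put \<open>\<Gamma> = \<Lambda> \<inter> H\<close> and enlarge \<open>P\<close> to
  \<open>\<Gamma> + P\<close>: differences of points of \<open>\<Gamma> + P\<close> lie in the closure of \<open>\<Lambda> + \<Lambda> + \<Lambda> + \<Lambda>\<close>, in which \<open>0\<close> is
  isolated, so these sets have uniformly bounded local density and the expected number of points
  is a locally finite right invariant measure \<open>\<nu>\<close> on \<open>G\<close>. As \<open>G\<close> is unimodular, \<open>\<nu>\<close> is also left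
  invariant. Write \<open>H = \<Gamma> + F\<close> with \<open>F\<close> of finite Haar measure and lift \<open>L\<close> to a compact set; each
  coset in \<open>L\<close> that meets \<open>P\<close> forces \<open>\<Gamma> + P\<close> to meet \<open>F + k\<close> for all \<open>k\<close> in that coset. Averaging
  over \<open>k\<close> in a compact set \<open>T\<close> bounds the expected number of these cosets by a constant multiple of
  \<open>m\<^sub>H F \<cdot> \<nu> T < \<infinity>\<close>.
\<close>

subsection \<open>Discrete approximate subgroups\<close>

text \<open>The set of points whose coset lies in \<open>L\<close> is unbounded along
  \<open>H\<close>, so local finiteness of \<open>P\<close> alone does not control how many cosets
  of \<open>L\<close> it meets. Adding \<Gamma> on the left moves points of \<open>P\<close> only
  within their cosets, as \<Gamma> lies in \<open>H\<close>; distinct cosets are disjoint, so no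
  point of \<Gamma> + P is charged to two of them. The set \<open>F\<close> has finite measure but
  may be unbounded, so the estimate is obtained only in mean, and the measure of \<open>F\<close>
  enters through Tonelli. That computation translates \<open>T\<close> on the left by points of
  \<open>F\<close>, whereas the action, P -> P - g, makes \<nu> invariant on the right; this gap is
  what unimodularity of the ambient group closes. The averaging is carried by the weight \<phi>(y) =
  \<open>mH\<close> {f in F. - f + y in T}, whose \<nu>-integral is the product of the masses of
  \<open>F\<close> and \<open>T\<close>. Four summands of \<Lambda> occur because differences within
  \<open>P\<close> lie in \<open>closure (\<Lambda> + \<Lambda>)\<close> and each of the two points
  of \<Gamma> + P brings one more element of \<Lambda>.\<close>

lemma open_vimage_add_left:
  fixes V :: "'a::topological_group_add set"
  assumes "open V" shows "open {v. a + v \<in> V}"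
proof -
  have "open ((\<lambda>v. a + v) -` V)" by (intro open_vimage assms continuous_intros)
  then show ?thesis by (simp add: vimage_def)
qed

lemma closure_add_subset:
  fixes A B :: "'a::topological_group_add set"
  shows "closure A + closure B \<subseteq> closure (A + B)"
proof -
  have "(\<lambda>(x, y). x + y) ` closure (A \<times> B) \<subseteq> closure (A + B)"
    by (rule image_closure_subset)
      (auto simp: case_prod_unfold intro!: continuous_intros closure_subset[THEN subsetD])
  then show ?thesis by (auto simp: closure_Times set_plus_def)
qed

lemma closure_uminus:
  fixes A :: "'a::topological_group_add set"
  assumes "\<And>x. x \<in> A \<Longrightarrow> - x \<in> A" "x \<in> closure A"
  shows "- x \<in> closure A"
proof -
  have "uminus ` closure A \<subseteq> closure A"
    by (rule image_closure_subset)
      (auto intro!: continuous_intros closure_subset[THEN subsetD] assms)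
  then show ?thesis using assms by auto
qed

lemma closure_add_finite:
  fixes A :: "'a::{topological_group_add, t2_space} set"
  assumes "finite F"
  shows "closure (A + F) \<subseteq> closure A + F"
proof (rule closure_minimal)
  show "A + F \<subseteq> closure A + F" by (intro set_plus_mono2 closure_subset order_refl)
  have "closure A + F = (\<Union>f\<in>F. {x. x - f \<in> closure A})"
  proof (intro equalityI subsetI)
    fix x assume "x \<in> (\<Union>f\<in>F. {x. x - f \<in> closure A})"
    then obtain f where "f \<in> F" "x - f \<in> closure A" by blast
    then show "x \<in> closure A + F" using set_plus_intro[of "x - f" _ f F] by simp
  next
    fix x assume "x \<in> closure A + F"
    then obtain a f where "x = a + f" "a \<in> closure A" "f \<in> F" by (auto simp: set_plus_def)
    then show "x \<in> (\<Union>f\<in>F. {x. x - f \<in> closure A})" by (intro UN_I[of f]) auto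
  qed
  moreover have "closed {x. x - f \<in> closure A}" for f
  proof -
    have "closed ((\<lambda>x. x - f) -` closure A)"
      by (intro closed_vimage closed_closure continuous_intros)
    then show ?thesis by (simp add: vimage_def)
  qed
  ultimately show "closed (closure A + F)" using assms by auto
qed

text \<open>Of the finitely many translates of \<open>closure \<Lambda>\<close> that cover \<open>closure E\<close>, only those
  through \<open>0\<close> matter near \<open>0\<close>, and these lie in \<open>closure (\<Lambda> + \<Lambda>)\<close>.\<close>

lemma covered_near_zero:
  fixes \<Lambda> :: "'a::{topological_group_add, t2_space} set"
  assumes sym: "\<And>x. x \<in> \<Lambda> \<Longrightarrow> - x \<in> \<Lambda>" and F: "finite F" "E \<subseteq> \<Lambda> + F"
  obtains V where "open V" "0 \<in> V" "closure E \<inter> V \<subseteq> closure (\<Lambda> + \<Lambda>)"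
proof
  define V where "V = (\<Inter>f\<in>{f\<in>F. - f \<notin> closure \<Lambda>}. {x. x - f \<notin> closure \<Lambda>})"
  have "open {x. x - f \<notin> closure \<Lambda>}" for f
  proof -
    have "open ((\<lambda>x. x - f) -` (- closure \<Lambda>))"
      by (intro open_vimage continuous_intros) auto
    then show ?thesis by (simp add: vimage_def)
  qed
  then show "open V" unfolding V_def using F by (intro open_INT) auto
  show "0 \<in> V" by (auto simp: V_def)
  show "closure E \<inter> V \<subseteq> closure (\<Lambda> + \<Lambda>)"
  proof
    fix x assume x: "x \<in> closure E \<inter> V"
    then have "x \<in> closure \<Lambda> + F"
      using closure_mono[OF F(2)] closure_add_finite[OF F(1)] by blast
    then obtain l f where lf: "x = l + f" "l \<in> closure \<Lambda>" "f \<in> F" by (auto simp: set_plus_def)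
    then have "- f \<in> closure \<Lambda>" using x unfolding V_def by force
    then have "f \<in> closure \<Lambda>" using closure_uminus[OF sym] by force
    then show "x \<in> closure (\<Lambda> + \<Lambda>)" using lf closure_add_subset by blast
  qed
qed

text \<open>The finite set sits on the right, so \<open>\<Lambda> + (\<Lambda> + F')\<close>
  regroups as \<open>(\<Lambda> + \<Lambda>) + F'\<close> and the approximate subgroup property
  applies. Iteration covers every finite power of \<Lambda> by finitely many right translates of
  \<Lambda>.\<close>

lemma covered_add:
  fixes \<Lambda> :: "'a::topological_group_add set"
  assumes "\<Lambda> + \<Lambda> \<subseteq> \<Lambda> + F" "finite F" and E: "\<exists>F. finite F \<and> E \<subseteq> \<Lambda> + F"
  shows "\<exists>F. finite F \<and> \<Lambda> + E \<subseteq> \<Lambda> + F"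
proof -
  obtain F' where F': "finite F'" "E \<subseteq> \<Lambda> + F'" using E by blast
  have "\<Lambda> + E \<subseteq> \<Lambda> + (\<Lambda> + F')" using F' by (intro set_plus_mono2) auto
  also have "\<dots> = (\<Lambda> + \<Lambda>) + F'" by (simp add: add.assoc)
  also have "\<dots> \<subseteq> (\<Lambda> + F) + F'" by (rule set_plus_mono2[OF assms(1) order_refl])
  also have "\<dots> = \<Lambda> + (F + F')" by (simp add: add.assoc)
  finally show ?thesis using F'(1) assms(2) finite_set_plus by blast
qed

text \<open>The set \<open>\<Lambda>\<close> is only assumed to be relatively discrete, so a Baire argument is needed: a
  translate of a neighbourhood of \<open>0\<close> in \<open>closure (\<Lambda> + \<Lambda>)\<close> lies in a single translate of
  \<open>closure \<Lambda>\<close>, and the isolated points \<open>\<Lambda>\<close> are dense there.\<close>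

lemma discrete_approximate_subgroup_isolated:
  fixes \<Lambda> :: "'a::{topological_group_add, t2_space} set"
  assumes "discrete \<Lambda>" and as: "approximate_subgroup K \<Lambda>"
  obtains V where "open V" "0 \<in> V" "closure (\<Lambda> + \<Lambda> + (\<Lambda> + \<Lambda>)) \<inter> V \<subseteq> {0}"
proof -
  have sym: "\<And>x. x \<in> \<Lambda> \<Longrightarrow> - x \<in> \<Lambda>" and z: "0 \<in> \<Lambda>"
    using as by (auto simp: approximate_subgroup_def)
  obtain F where F: "finite F" "\<Lambda> + \<Lambda> \<subseteq> \<Lambda> + F"
    using as by (auto simp: approximate_subgroup_def)
  define D2 where "D2 = \<Lambda> + \<Lambda>"
  define D4 where "D4 = D2 + D2"
  \<comment> \<open>Eight summands suffice: the point \<open>y\<close> constructed below is a sum of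
    two elements of \<open>closure D4\<close>. Inside \<open>W\<close> everything in
    \<open>closure D8\<close> falls back into \<open>closure D2\<close>, so sums can be formed
    repeatedly without growing.\<close>
  define D8 where "D8 = D4 + D4"
  let ?cov = "\<lambda>E. \<exists>F. finite F \<and> E \<subseteq> \<Lambda> + F"
  have c0: "?cov \<Lambda>" by (intro exI[of _ "{0}"]) (auto simp: set_plus_def)
  note c = covered_add[OF F(2,1)]
  have "?cov D8" unfolding D8_def D4_def D2_def add.assoc by (intro c c0)
  then obtain F8 where F8: "finite F8" "D8 \<subseteq> \<Lambda> + F8" by blast
  have "?cov D2" unfolding D2_def by (intro c c0)
  then obtain F2 where F2: "finite F2" "D2 \<subseteq> \<Lambda> + F2" by blast
  obtain W where W: "open W" "0 \<in> W" "closure D8 \<inter> W \<subseteq> closure D2"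
    using covered_near_zero[OF sym F8] unfolding D2_def by blast
  have mono: "A \<subseteq> A + B" if "0 \<in> B" for A B :: "'a set"
    using that by (force simp: set_plus_def)
  have z2: "0 \<in> D2" and z4: "0 \<in> D4" using z by (force simp: D2_def D4_def set_plus_def)+
  have sub: "\<Lambda> \<subseteq> D2" "D2 \<subseteq> D4" "D4 \<subseteq> D8"
    using mono z z2 z4 unfolding D2_def D4_def D8_def by blast+
  have cs: "closure \<Lambda> \<subseteq> closure D2" "closure D2 \<subseteq> closure D4" "closure D4 \<subseteq> closure D8"
    using sub closure_mono by blast+
  have sym2: "- x \<in> D2" if "x \<in> D2" for x
  proof -
    obtain a b where "x = a + b" "a \<in> \<Lambda>" "b \<in> \<Lambda>" using \<open>x \<in> D2\<close> by (auto simp: D2_def set_plus_def)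
    then show ?thesis using sym set_plus_intro[of "- b" \<Lambda> "- a" \<Lambda>] by (simp add: D2_def minus_add)
  qed
  have add1: "x + y \<in> closure D2" if "x \<in> closure \<Lambda>" "y \<in> closure \<Lambda>" for x y
    using that closure_add_subset[of \<Lambda> \<Lambda>] unfolding D2_def by (auto simp: set_plus_def)
  have add2: "x + y \<in> closure D4" if "x \<in> closure D2" "y \<in> closure D2" for x y
    using that closure_add_subset[of D2 D2] unfolding D4_def by (auto simp: set_plus_def)
  have add4: "x + y \<in> closure D8" if "x \<in> closure D4" "y \<in> closure D4" for x y
    using that closure_add_subset[of D4 D4] unfolding D8_def by (auto simp: set_plus_def)
  \<comment> \<open>\<open>Pr \<Phi> x V\<close> says that the part of \<open>x + closure D2\<close>
    near \<open>x\<close> is covered by the right translates of \<open>closure \<Lambda>\<close> by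
    \<Phi>. The conditions involving \<open>W\<close> make sums fall back into
    \<open>closure D2\<close>. Minimizing \<open>card \<Phi>\<close> over all base points
    \<open>x\<close> takes the place of the Baire category theorem, since the cover is finite and
    closed.\<close>
  define Pr where "Pr \<Phi> x V \<longleftrightarrow> finite \<Phi> \<and> x \<in> closure D2 \<and> open V \<and> 0 \<in> V \<and> V \<subseteq> W \<and>
      (\<forall>v\<in>V. x + v \<in> W) \<and> (\<forall>y\<in>closure D2 \<inter> V. \<exists>f\<in>\<Phi>. x + y - f \<in> closure \<Lambda>)" for \<Phi> x V
  have "Pr F2 0 W" unfolding Pr_def
  proof (intro conjI ballI)
    fix y assume "y \<in> closure D2 \<inter> W"
    then have "y \<in> closure \<Lambda> + F2"
      using closure_mono[OF F2(2)] closure_add_finite[OF F2(1)] by blast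
    then show "\<exists>f\<in>F2. 0 + y - f \<in> closure \<Lambda>" by (auto simp: set_plus_def) (metis add_diff_cancel)
  qed (use F2 W z2 in \<open>auto intro: closure_subset[THEN subsetD]\<close>)
  then have ex: "\<exists>x V. Pr F2 x V" by blast
  obtain \<Phi> where "\<exists>x V. Pr \<Phi> x V"
    and min: "\<And>\<Psi>. \<exists>x V. Pr \<Psi> x V \<Longrightarrow> card \<Phi> \<le> card \<Psi>"
    using ex_has_least_nat[of "\<lambda>\<Phi>. \<exists>x V. Pr \<Phi> x V", OF ex, of card] by blast
  then obtain x V where Pr: "Pr \<Phi> x V" by blast
  have xV: "finite \<Phi>" "x \<in> closure D2" "open V" "0 \<in> V" "V \<subseteq> W"
    and xW: "\<And>v. v \<in> V \<Longrightarrow> x + v \<in> W"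
    and cov: "\<And>y. y \<in> closure D2 \<Longrightarrow> y \<in> V \<Longrightarrow> \<exists>f\<in>\<Phi>. x + y - f \<in> closure \<Lambda>"
    using Pr unfolding Pr_def by auto
  have all: "x + y - f \<in> closure \<Lambda>" if y: "y \<in> closure D2" "y \<in> V" and f: "f \<in> \<Phi>" for y f
  proof (rule ccontr)
    assume n: "x + y - f \<notin> closure \<Lambda>"
    define V' where "V' = V \<inter> {v. y + v \<in> V} \<inter> {v. x + y + v - f \<notin> closure \<Lambda>}"
    have o: "open {v. x + y + v - f \<notin> closure \<Lambda>}"
    proof -
      have "open ((\<lambda>v. x + y + v - f) -` (- closure \<Lambda>))"
        by (intro open_vimage continuous_intros) auto
      then show ?thesis by (simp add: vimage_def)
    qed
    have "Pr (\<Phi> - {f}) (x + y) V'" unfolding Pr_def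
    proof (intro conjI ballI)
      show "finite (\<Phi> - {f})" using xV by simp
      have "x + y \<in> closure D4" using add2 xV y by blast
      moreover have "x + y \<in> W" using xW y by blast
      ultimately show "x + y \<in> closure D2" using W cs by blast
      show "open V'" unfolding V'_def using xV o open_vimage_add_left[of V y] by auto
      show "0 \<in> V'" using xV y n by (auto simp: V'_def)
      show "V' \<subseteq> W" using xV by (auto simp: V'_def)
      show "x + y + v \<in> W" if "v \<in> V'" for v
        using that xW[of "y + v"] by (auto simp: V'_def add.assoc)
      fix u assume u: "u \<in> closure D2 \<inter> V'"
      then have "y + u \<in> closure D4" "y + u \<in> V" using add2 y by (auto simp: V'_def)
      then have "y + u \<in> closure D2" using W cs xV by blast
      then obtain f' where f': "f' \<in> \<Phi>" "x + (y + u) - f' \<in> closure \<Lambda>"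
        using cov \<open>y + u \<in> V\<close> by blast
      moreover have "f' \<noteq> f" using f' u by (auto simp: V'_def add.assoc)
      ultimately show "\<exists>f\<in>\<Phi> - {f}. x + y + u - f \<in> closure \<Lambda>" by (auto simp: add.assoc)
    qed
    then have "card \<Phi> \<le> card (\<Phi> - {f})" using min by blast
    then show False using xV f by (metis card_Diff1_less leD)
  qed
  have 02: "0 \<in> closure D2" using z2 closure_subset by blast
  obtain f where f: "f \<in> \<Phi>" using cov[OF 02] xV by blast
  define \<mu> where "\<mu> = x - f"
  have \<mu>: "\<mu> \<in> closure \<Lambda>" using all[OF 02 _ f] xV by (simp add: \<mu>_def)
  have feq: "f = - \<mu> + x" by (simp add: \<mu>_def minus_diff_eq)
  \<comment> \<open>The point \<open>\<mu>\<close> is only known to lie in the closure of \<Lambda>,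
    while isolation holds for points of \<Lambda> itself. Since \<open>- x + \<mu> + f = 0\<close>,
    nearby points \<open>l\<close> of \<Lambda> still give a small displacement
    \<open>- x + l + f\<close>.\<close>
  have "open {l. - x + l + f \<in> V}"
  proof -
    have "open ((\<lambda>l. - x + l + f) -` V)" by (intro open_vimage continuous_intros xV)
    then show ?thesis by (simp add: vimage_def)
  qed
  moreover have "\<mu> \<in> {l. - x + l + f \<in> V}" using xV by (simp add: feq add.assoc)
  ultimately obtain l where l: "l \<in> \<Lambda>" "- x + l + f \<in> V"
    using \<mu> closure_iff_nhds_not_empty[of \<mu> \<Lambda>] by blast
  \<comment> \<open>Chosen so that \<open>x + y - f = l\<close>, which puts an isolated point at the
    new base point. It is the conjugate of \<open>l - \<mu>\<close> by \<open>x\<close>, and this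
    form bounds the number of summands.\<close>
  define y where "y = - x + l + f"
  have "y = (- x + (l + - \<mu>)) + x"
    unfolding y_def by (simp only: feq add.assoc)
  moreover have m: "- \<mu> \<in> closure \<Lambda>" "- x \<in> closure D2" "l \<in> closure \<Lambda>"
    using closure_uminus[OF sym \<mu>] closure_uminus[OF sym2 xV(2)] l closure_subset by auto
  moreover have "- x + (l + - \<mu>) \<in> closure D4" using add2[OF m(2) add1[OF m(3,1)]] .
  moreover have "x \<in> closure D4" using cs xV by blast
  ultimately have "y \<in> closure D8" using add4 by simp
  then have y: "y \<in> closure D2" "y \<in> V" using W xV l by (auto simp: y_def)
  have "l isolated_in \<Lambda>" using assms(1) l by (simp add: discrete_def)
  then obtain U where "open U" "U \<inter> \<Lambda> = {l}"
    unfolding isolated_in_def by (elim conjE exE)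
  then have U: "open U" "\<Lambda> \<inter> U = {l}" by (simp_all add: Int_commute)
  \<comment> \<open>For \<open>v\<close> in this set,
    \<open>x + (y + v) - f = l + (f + v - f)\<close> lies in \<open>closure \<Lambda>\<close> by
    \<open>all\<close> and in \<open>U\<close>, where the only point of
    \<open>closure \<Lambda>\<close> is \<open>l\<close>. This forces \<open>v = 0\<close>.\<close>
  define V' where "V' = V \<inter> {v. y + v \<in> V} \<inter> {v. l + (f + v - f) \<in> U}"
  have o: "open {v. l + (f + v - f) \<in> U}"
  proof -
    have "open ((\<lambda>v. l + (f + v - f)) -` U)" by (intro open_vimage continuous_intros U)
    then show ?thesis by (simp add: vimage_def)
  qed
  show thesis
  proof
    show "open V'" unfolding V'_def using xV o open_vimage_add_left[of V y] by auto
    show "0 \<in> V'" using xV y U by (auto simp: V'_def)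
    show "closure (\<Lambda> + \<Lambda> + (\<Lambda> + \<Lambda>)) \<inter> V' \<subseteq> {0}"
    proof
      fix v assume "v \<in> closure (\<Lambda> + \<Lambda> + (\<Lambda> + \<Lambda>)) \<inter> V'"
      then have v: "v \<in> closure D4" "v \<in> V'" by (auto simp: D4_def D2_def)
      then have "v \<in> closure D2" using W cs xV by (auto simp: V'_def)
      then have "y + v \<in> closure D4" "y + v \<in> V" using add2 y v by (auto simp: V'_def)
      then have "y + v \<in> closure D2" using W cs xV by blast
      then have "x + (y + v) - f \<in> closure \<Lambda>" using all f \<open>y + v \<in> V\<close> by blast
      also have "x + (y + v) = l + (f + v)" by (simp add: y_def add.assoc)
      also have "l + (f + v) - f = l + (f + v - f)" by (simp only: add_diff_eq)
      finally have 1: "l + (f + v - f) \<in> closure \<Lambda>" .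
      have 2: "l + (f + v - f) \<in> U" using v by (auto simp: V'_def)
      have "l + (f + v - f) = l"
      proof (rule ccontr)
        assume "l + (f + v - f) \<noteq> l"
        then have "l + (f + v - f) \<in> U - {l}" using 2 by blast
        moreover have "open (U - {l})" using U by auto
        ultimately have "\<Lambda> \<inter> (U - {l}) \<noteq> {}" using 1 closure_iff_nhds_not_empty by blast
        then show False using U by blast
      qed
      then have "l + (f + v - f) = l + 0" by simp
      then have "f + v - f = 0" by (rule add_left_imp_eq)
      then have "f + v = f + 0" by simp
      then show "v \<in> {0}" using add_left_imp_eq by blast
    qed
  qed
qed

subsection \<open>Unimodularity and invariant measures\<close>

lemma compact_neighbourhood:
  assumes "locally compact (UNIV :: 'a::topological_space set)" "open U" "(x::'a) \<in> U"
  obtains V K where "open V" "compact K" "x \<in> V" "V \<subseteq> K" "K \<subseteq> U"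
proof -
  have "\<exists>V K. open V \<and> compact K \<and> x \<in> V \<and> V \<subseteq> K \<and> K \<subseteq> U"
    using assms(1)[unfolded locally_def, rule_format, of U x] assms(2,3) by simp
  then show thesis using that by (elim exE conjE)
qed

text \<open>Lindelof, applied to the open sets that lie in a compact subset of \<open>U\<close>.
  Besides sigma-finiteness it serves measurability: it splits the event of hitting a closed set
  intersected with an open one into events of hitting compact sets.\<close>

lemma open_sigma_compact:
  fixes U :: "'a::second_countable_topology set"
  assumes "locally compact (UNIV :: 'a set)" "open U"
  obtains \<K> where "countable \<K>" "\<And>K. K \<in> \<K> \<Longrightarrow> compact K" "\<Union>\<K> = U"
proof -
  define \<F> where "\<F> = {V. open V \<and> (\<exists>K. compact K \<and> V \<subseteq> K \<and> K \<subseteq> U)}"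
  have UF: "\<Union>\<F> = U"
  proof (intro equalityI subsetI)
    fix x assume "x \<in> U"
    from compact_neighbourhood[OF assms this] obtain V K
      where "open V" "compact K" "x \<in> V" "V \<subseteq> K" "K \<subseteq> U" .
    then have "V \<in> \<F>" unfolding \<F>_def by blast
    with \<open>x \<in> V\<close> show "x \<in> \<Union>\<F>" by (rule UnionI[rotated])
  qed (simp add: \<F>_def, blast)
  obtain \<F>' where \<F>': "\<F>' \<subseteq> \<F>" "countable \<F>'" "\<Union>\<F>' = \<Union>\<F>"
    by (rule Lindelof[of \<F>]) (simp add: \<F>_def)
  have "\<forall>V\<in>\<F>'. \<exists>K. compact K \<and> V \<subseteq> K \<and> K \<subseteq> U"
  proof
    fix V assume "V \<in> \<F>'"
    from subsetD[OF \<F>'(1) this] show "\<exists>K. compact K \<and> V \<subseteq> K \<and> K \<subseteq> U" by (simp add: \<F>_def)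
  qed
  then obtain k where k: "\<forall>V\<in>\<F>'. compact (k V) \<and> V \<subseteq> k V \<and> k V \<subseteq> U"
    by (rule bchoice[THEN exE])
  show thesis
  proof (rule that)
    show "countable (k ` \<F>')" using \<F>' by simp
    show "compact K" if "K \<in> k ` \<F>'" for K using that k by auto
    have "\<Union>\<F>' \<subseteq> \<Union>(k ` \<F>')" using k by fast
    moreover have "\<Union>(k ` \<F>') \<subseteq> U" using k by (intro UN_least) fast
    ultimately show "\<Union>(k ` \<F>') = U" using \<F>'(3) UF by auto
  qed
qed

lemma sigma_finite_of_finite_on_compact:
  fixes M :: "'a::{second_countable_topology, t2_space} measure"
  assumes "locally compact (UNIV :: 'a set)" and M: "sets M = sets borel"
    and fin: "\<And>K. compact K \<Longrightarrow> emeasure M K < \<infinity>"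
  shows "sigma_finite_measure M"
proof -
  obtain \<K> where K: "countable \<K>" "\<And>K. K \<in> \<K> \<Longrightarrow> compact K" "\<Union>\<K> = (UNIV :: 'a set)"
    using open_sigma_compact[OF assms(1) open_UNIV] by blast
  have "space M = UNIV" using sets_eq_imp_space_eq[OF M] by simp
  moreover have "K \<in> sets M" if "K \<in> \<K>" for K
    using K(2)[OF that] M by (simp add: borel_closed compact_imp_closed)
  moreover have "emeasure M K \<noteq> \<infinity>" if "K \<in> \<K>" for K using fin[OF K(2)[OF that]] by simp
  ultimately show ?thesis
    using K(1,3) by (intro sigma_finite_measure.intro exI[of _ \<K>]) auto
qed

lemma nn_integral_invariant:
  assumes "distr M N T = M" "T \<in> measurable M N" "f \<in> borel_measurable N"
  shows "(\<integral>\<^sup>+x. f (T x) \<partial>M) = (\<integral>\<^sup>+x. f x \<partial>M)"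
proof -
  have "(\<integral>\<^sup>+x. f x \<partial>distr M N T) = (\<integral>\<^sup>+x. f (T x) \<partial>M)"
    using assms(3) by (intro nn_integral_distr[OF assms(2)]) simp
  then show ?thesis using assms(1) by simp
qed

lemma borel_measurable_group_add:
  fixes f g :: "'b \<Rightarrow> 'a::{topological_group_add, second_countable_topology}"
  assumes "f \<in> borel_measurable M" "g \<in> borel_measurable M"
  shows "(\<lambda>x. f x + g x) \<in> borel_measurable M"
  using assms by (rule borel_measurable_continuous_Pair) (intro continuous_intros)

lemma borel_measurable_group_uminus:
  "(uminus :: 'a::{topological_group_add, t2_space} \<Rightarrow> 'a) \<in> borel_measurable borel"
  by (intro borel_measurable_continuous_onI continuous_intros)

lemma borel_measurable_group_diff:
  fixes f g :: "'b \<Rightarrow> 'a::{topological_group_add, t2_space, second_countable_topology}"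
  assumes "f \<in> borel_measurable M" "g \<in> borel_measurable M"
  shows "(\<lambda>x. f x - g x) \<in> borel_measurable M"
  using borel_measurable_group_add[OF assms(1)
      measurable_compose[OF assms(2) borel_measurable_group_uminus]]
  by (simp only: add_uminus_conv_diff)

text \<open>The computation behind uniqueness of Haar measure: Tonelli for the integral of 1_A(x)
  1_B(x + y). Left invariance of \<open>m\<close> evaluates it as the left side; right invariance of
  \<nu> turns the integrand into 1_A(x - y) 1_B(x), and right invariance of \<open>m\<close> then
  removes \<open>x\<close> from 1_A(x - y) and leaves the reflection of \<open>A\<close>. So \<nu>
  is proportional to the reflected \<open>m\<close>, stated without division.\<close>

lemma right_invariant_reflection:
  fixes \<nu> m :: "'a::{topological_group_add, t2_space, second_countable_topology} measure"
  assumes sets[measurable_cong]: "sets \<nu> = sets borel" "sets m = sets borel"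
    and sf: "sigma_finite_measure \<nu>" "sigma_finite_measure m"
    and \<nu>: "\<And>g. distr \<nu> borel (\<lambda>x. x + g) = \<nu>"
    and m: "\<And>g. distr m borel (\<lambda>x. g + x) = m" "\<And>g. distr m borel (\<lambda>x. x + g) = m"
    and AB[measurable]: "A \<in> sets borel" "B \<in> sets borel"
  shows "emeasure \<nu> A * emeasure m B = emeasure \<nu> B * emeasure m {x. - x \<in> A}"
proof -
  interpret pair_sigma_finite \<nu> m using sf by (simp add: pair_sigma_finite_def)
  note [measurable] = borel_measurable_group_add borel_measurable_group_diff borel_measurable_group_uminus
  have uA: "{x. - x \<in> A} \<in> sets borel"
    using measurable_sets[OF borel_measurable_group_uminus AB(1)] by (simp add: vimage_def)
  have "emeasure \<nu> A * emeasure m B = (\<integral>\<^sup>+x. indicator A x * (\<integral>\<^sup>+y. indicator B y \<partial>m) \<partial>\<nu>)"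
    using AB sets by (simp add: nn_integral_multc)
  also have "\<dots> = (\<integral>\<^sup>+x. \<integral>\<^sup>+y. indicator A x * indicator B (x + y) \<partial>m \<partial>\<nu>)"
  proof (rule nn_integral_cong)
    fix x
    have "(\<integral>\<^sup>+y. indicator B (x + y) \<partial>m) = (\<integral>\<^sup>+y. indicator B y \<partial>m)"
      by (rule nn_integral_invariant[OF m(1)]) measurable
    then show "indicator A x * (\<integral>\<^sup>+y. indicator B y \<partial>m) = (\<integral>\<^sup>+y. indicator A x * indicator B (x + y) \<partial>m)"
      by (subst nn_integral_cmult) auto
  qed
  also have "\<dots> = (\<integral>\<^sup>+y. \<integral>\<^sup>+x. indicator A x * indicator B (x + y) \<partial>\<nu> \<partial>m)"
    by (rule Fubini'[symmetric]) measurable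
  also have "\<dots> = (\<integral>\<^sup>+y. \<integral>\<^sup>+x. indicator A (x - y) * indicator B x \<partial>\<nu> \<partial>m)"
  proof (rule nn_integral_cong)
    fix y
    have "(\<integral>\<^sup>+x. indicator A (x + y - y) * indicator B (x + y) \<partial>\<nu>) = (\<integral>\<^sup>+x. indicator A (x - y) * indicator B x \<partial>\<nu>)"
      by (rule nn_integral_invariant[OF \<nu>]) measurable
    then show "(\<integral>\<^sup>+x. indicator A x * indicator B (x + y) \<partial>\<nu>) = (\<integral>\<^sup>+x. indicator A (x - y) * indicator B x \<partial>\<nu>)"
      by simp
  qed
  also have "\<dots> = (\<integral>\<^sup>+x. \<integral>\<^sup>+y. indicator A (x - y) * indicator B x \<partial>m \<partial>\<nu>)"
    by (rule Fubini') measurable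
  also have "\<dots> = (\<integral>\<^sup>+x. emeasure m {x. - x \<in> A} * indicator B x \<partial>\<nu>)"
  proof (rule nn_integral_cong)
    fix x
    have "(\<integral>\<^sup>+y. indicator A (x - (y + x)) \<partial>m) = (\<integral>\<^sup>+y. indicator A (x - y) \<partial>m)"
      by (rule nn_integral_invariant[OF m(2)]) measurable
    moreover have "x - (y + x) = - y" for y by (simp add: diff_add_eq_diff_diff_swap)
    moreover have "(\<integral>\<^sup>+y. indicator A (- y) \<partial>m) = (\<integral>\<^sup>+y. indicator {x. - x \<in> A} y \<partial>m)"
      by (intro nn_integral_cong) (auto simp: indicator_def)
    ultimately have "(\<integral>\<^sup>+y. indicator A (x - y) \<partial>m) = emeasure m {x. - x \<in> A}"
      using uA sets by simp
    then show "(\<integral>\<^sup>+y. indicator A (x - y) * indicator B x \<partial>m) = emeasure m {x. - x \<in> A} * indicator B x"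
      by (subst nn_integral_multc) auto
  qed
  also have "\<dots> = emeasure m {x. - x \<in> A} * emeasure \<nu> B"
    using AB sets by (simp add: nn_integral_cmult)
  finally show ?thesis by (simp add: mult.commute)
qed

text \<open>Reflection turns a left translate of \<open>A\<close> into a right translate of its
  reflection, which has the same \<open>m\<close>-mass. The reference set \<open>B\<close> of finite
  positive mass can then be cancelled.\<close>

lemma right_invariant_imp_left_invariant:
  fixes \<nu> m :: "'a::{topological_group_add, t2_space, second_countable_topology} measure"
  assumes sets[measurable_cong]: "sets \<nu> = sets borel" "sets m = sets borel"
    and sf: "sigma_finite_measure \<nu>" "sigma_finite_measure m"
    and \<nu>: "\<And>g. distr \<nu> borel (\<lambda>x. x + g) = \<nu>"
    and m: "\<And>g. distr m borel (\<lambda>x. g + x) = m" "\<And>g. distr m borel (\<lambda>x. x + g) = m"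
    and B: "B \<in> sets borel" "0 < emeasure m B" "emeasure m B < \<infinity>"
    and A: "A \<in> sets borel"
  shows "emeasure \<nu> {x. g + x \<in> A} = emeasure \<nu> A"
proof -
  note [measurable] = borel_measurable_group_add borel_measurable_group_uminus A
  have 1: "{x. g + x \<in> A} \<in> sets borel" and 2: "{x. - x \<in> A} \<in> sets borel" by measurable
  have meas: "(\<lambda>x. x + - g) \<in> borel_measurable m" by measurable
  have "{x. - x \<in> {x. g + x \<in> A}} = (\<lambda>x. x + - g) -` {x. - x \<in> A} \<inter> space m"
    using sets_eq_imp_space_eq[OF sets(2)] by (auto simp: minus_diff_eq)
  then have "emeasure m {x. - x \<in> {x. g + x \<in> A}} = emeasure (distr m borel (\<lambda>x. x + - g)) {x. - x \<in> A}"
    using emeasure_distr[OF meas 2] by simp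
  then have "emeasure m {x. - x \<in> {x. g + x \<in> A}} = emeasure m {x. - x \<in> A}"
    using m(2)[of "- g"] by simp
  then have "emeasure \<nu> {x. g + x \<in> A} * emeasure m B = emeasure \<nu> A * emeasure m B"
    using right_invariant_reflection[OF sets sf \<nu> m 1 B(1)]
      right_invariant_reflection[OF sets sf \<nu> m A B(1)] by simp
  then show ?thesis using B
    by (auto simp: mult.commute[of _ "emeasure m B"] ennreal_mult_cancel_left)
qed

subsection \<open>Haar measures of closed subgroups\<close>

text \<open>The push-forward along the inclusion of \<open>K\<close>. It allows Haar measures of the
  subgroup and measures on the whole group to be integrated over one and the same Borel
  sigma-algebra.\<close>

lemma haar_measure_extension:
  fixes K :: "'a::{topological_group_add, t2_space} set"
  assumes K: "closed_subgroup K" and m: "left_haar_measure K m"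
  obtains m' where "sets m' = sets borel" "\<And>C. compact C \<Longrightarrow> emeasure m' C < \<infinity>"
    "\<And>A. A \<in> sets m \<Longrightarrow> A \<in> sets borel \<and> A \<subseteq> K \<and> emeasure m' A = emeasure m A"
    "\<And>k A. k \<in> K \<Longrightarrow> A \<in> sets borel \<Longrightarrow> emeasure m' {x. k + x \<in> A} = emeasure m' A"
    "emeasure m' (- K) = 0" "emeasure m' UNIV \<noteq> 0"
proof -
  have Kb: "K \<in> sets borel" and cl: "closed K" using K by (auto simp: closed_subgroup_def)
  have sm: "sets m = sets (restrict_space borel K)" using m by (simp add: left_haar_measure_def)
  then have sp: "space m = K" using sets_eq_imp_space_eq[OF sm] by (simp add: space_restrict_space)
  have sm': "A \<in> sets m \<longleftrightarrow> A \<in> sets borel \<and> A \<subseteq> K" for A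
    using Kb by (auto simp: sm sets_restrict_space_iff)
  have id: "(\<lambda>x. x) \<in> measurable m borel"
    unfolding measurable_cong_sets[OF sm refl] by (rule measurable_restrict_space1) simp
  define m' where "m' = distr m borel (\<lambda>x. x)"
  have em: "emeasure m' A = emeasure m (A \<inter> K)" if "A \<in> sets borel" for A
    unfolding m'_def using that id by (simp add: emeasure_distr sp)
  show thesis
  proof
    show "sets m' = sets borel" by (simp add: m'_def)
    show "emeasure m' C < \<infinity>" if "compact C" for C
      using that m cl em[of C]
      by (auto simp: left_haar_measure_def borel_closed compact_imp_closed compact_Int_closed)
    show "A \<in> sets borel \<and> A \<subseteq> K \<and> emeasure m' A = emeasure m A" if "A \<in> sets m" for A
      using that em[of A] by (auto simp: sm' Int_absorb2)
    show "emeasure m' (- K) = 0" using em[of "- K"] Kb by auto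
    show "emeasure m' UNIV \<noteq> 0" using em[of UNIV] m by (auto simp: left_haar_measure_def)
    fix k and A :: "'a set" assume k: "k \<in> K" and A: "A \<in> sets borel"
    have "(\<lambda>x. k + x) \<in> borel_measurable borel"
      by (intro borel_measurable_continuous_onI continuous_intros)
    from measurable_sets[OF this A] have "{x. k + x \<in> A} \<in> sets borel" by (simp add: vimage_def)
    then have "emeasure m' {x. k + x \<in> A} = emeasure m ({x. k + x \<in> A} \<inter> K)" by (rule em)
    also have "{x. k + x \<in> A} \<inter> K = (\<lambda>x. - k + x) ` (A \<inter> K)"
    proof (intro equalityI subsetI)
      fix x assume "x \<in> {x. k + x \<in> A} \<inter> K"
      then show "x \<in> (\<lambda>x. - k + x) ` (A \<inter> K)"
        using k K by (intro image_eqI[of _ _ "k + x"]) (auto simp: closed_subgroup_def add.assoc[symmetric])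
    qed (use k K in \<open>auto simp: closed_subgroup_def add.assoc[symmetric]\<close>)
    also have "emeasure m ((\<lambda>x. - k + x) ` (A \<inter> K)) = emeasure m (A \<inter> K)"
      using m k K A Kb by (auto simp: left_haar_measure_def closed_subgroup_def sm')
    finally show "emeasure m' {x. k + x \<in> A} = emeasure m' A" using em A by simp
  qed
qed

text \<open>If \<open>U\<close> were null, countably many of its translates by elements of
  \<open>K\<close> would cover \<open>K\<close> by Lindelof, and the measure, which lives on
  \<open>K\<close>, would vanish.\<close>

lemma left_invariant_open_pos:
  fixes m :: "'a::{topological_group_add, t2_space, second_countable_topology} measure"
  assumes m: "sets m = sets borel" "emeasure m (- K) = 0" "emeasure m UNIV \<noteq> 0"
    and inv: "\<And>k A. k \<in> K \<Longrightarrow> A \<in> sets borel \<Longrightarrow> emeasure m {x. k + x \<in> A} = emeasure m A"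
    and K: "closed_subgroup K" and U: "open U" "0 \<in> U"
  shows "emeasure m U > 0"
proof (rule ccontr)
  assume "\<not> emeasure m U > 0"
  then have 0: "emeasure m U = 0" by (simp add: zero_less_iff_neq_zero)
  define \<F> where "\<F> = (\<lambda>k. {x. - k + x \<in> U}) ` K"
  have "open V" if "V \<in> \<F>" for V
  proof -
    have "open ((\<lambda>x. - k + x) -` U)" for k by (intro open_vimage U continuous_intros)
    then show ?thesis using that by (auto simp: \<F>_def vimage_def)
  qed
  note oF = this
  obtain \<F>' where F: "\<F>' \<subseteq> \<F>" "countable \<F>'" "\<Union>\<F>' = \<Union>\<F>" using Lindelof[of \<F>] oF by blast
  have "V \<in> null_sets m" if "V \<in> \<F>'" for V
  proof -
    from subsetD[OF F(1) that] obtain k where "k \<in> K" "V = {x. - k + x \<in> U}"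
      unfolding \<F>_def by blast
    then have "emeasure m V = 0" using inv[of "- k" U] K U 0 by (simp add: closed_subgroup_def)
    then show ?thesis using oF that F m by (intro null_setsI) auto
  qed
  then have "(\<Union>V\<in>\<F>'. V) \<in> null_sets m" by (intro null_sets_UN' F)
  moreover have "- K \<in> null_sets m" using m K by (intro null_setsI) (auto simp: closed_subgroup_def)
  ultimately have "(\<Union>V\<in>\<F>'. V) \<union> - K \<in> null_sets m" by (rule null_sets.Un)
  moreover have "K \<subseteq> \<Union>\<F>" using U by (auto simp: \<F>_def)
  then have "(\<Union>V\<in>\<F>'. V) \<union> - K = UNIV" using F by auto
  ultimately show False using m by auto
qed

subsection \<open>Measurability of counting functions\<close>

lemma Hausdorff_finite_separation:
  assumes X: "Hausdorff_space X" and A: "finite A" "A \<subseteq> topspace X"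
  obtains d where "\<And>x. x \<in> A \<Longrightarrow> openin X (d x)" "\<And>x. x \<in> A \<Longrightarrow> x \<in> d x" "disjoint_family_on d A"
proof -
  have "\<exists>UV. openin X (fst UV) \<and> openin X (snd UV) \<and> x \<in> fst UV \<and> y \<in> snd UV \<and> disjnt (fst UV) (snd UV)"
    if "x \<in> A" "y \<in> A" "x \<noteq> y" for x y
  proof -
    have "\<exists>U V. openin X U \<and> openin X V \<and> x \<in> U \<and> y \<in> V \<and> disjnt U V"
      using X[unfolded Hausdorff_space_def, rule_format, of x y] that A by blast
    then show ?thesis by (simp add: split_paired_Ex)
  qed
  note ex = this
  define UV where "UV x y = (SOME UV. openin X (fst UV) \<and> openin X (snd UV) \<and> x \<in> fst UV
    \<and> y \<in> snd UV \<and> disjnt (fst UV) (snd UV))" for x y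
  have UV: "openin X (fst (UV x y)) \<and> openin X (snd (UV x y)) \<and> x \<in> fst (UV x y) \<and> y \<in> snd (UV x y)
      \<and> disjnt (fst (UV x y)) (snd (UV x y))" if "x \<in> A" "y \<in> A" "x \<noteq> y" for x y
    using someI_ex[OF ex[OF that]] unfolding UV_def .
  \<comment> \<open>The separating pair is chosen for ordered pairs, so \<open>UV x y\<close> and
    \<open>UV y x\<close> may be unrelated. Intersecting both choices gives \<open>d x\<close>
    inside the first and \<open>d y\<close> inside the second component of the same pair
    \<open>UV x y\<close>.\<close>
  define d where "d x = (\<Inter>y\<in>A - {x}. fst (UV x y) \<inter> snd (UV y x)) \<inter> topspace X" for x
  show thesis
  proof
    show "openin X (d x)" if "x \<in> A" for x
      unfolding d_def using A UV that by (intro openin_INT openin_Int) auto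
    show "x \<in> d x" if "x \<in> A" for x using A UV that by (auto simp: d_def)
    show "disjoint_family_on d A"
      unfolding disjoint_family_on_def
    proof (intro ballI impI)
      fix x y assume xy: "x \<in> A" "y \<in> A" "x \<noteq> y"
      then have "d x \<subseteq> fst (UV x y)" "d y \<subseteq> snd (UV x y)" by (auto simp: d_def)
      then show "d x \<inter> d y = {}" using UV[OF xy] unfolding disjnt_def by blast
    qed
  qed
qed

text \<open>A set has at least \<open>n\<close> points if and only if it meets \<open>n\<close> disjoint members of a base.\<close>

lemma count_eq_SUP_disjoint:
  assumes X: "Hausdorff_space X" and Q: "Q \<subseteq> topspace X"
    and base: "\<And>U x. openin X U \<Longrightarrow> x \<in> U \<Longrightarrow> \<exists>D\<in>\<D>. x \<in> D \<and> D \<subseteq> U"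
  shows "emeasure (count_space UNIV) Q =
    (SUP \<F>\<in>{\<F>. finite \<F> \<and> \<F> \<subseteq> \<D> \<and> disjoint \<F>}. of_nat (card {D\<in>\<F>. Q \<inter> D \<noteq> {}}))"
    (is "_ = (SUP \<F>\<in>?I. ?f \<F>)")
proof (rule antisym)
  have le: "of_nat (card A) \<le> (SUP \<F>\<in>?I. ?f \<F> :: ennreal)" if A: "finite A" "A \<subseteq> Q" for A
  proof -
    obtain d where d: "\<And>x. x \<in> A \<Longrightarrow> openin X (d x)" "\<And>x. x \<in> A \<Longrightarrow> x \<in> d x" "disjoint_family_on d A"
      by (rule Hausdorff_finite_separation[OF X A(1) order_trans[OF A(2) Q]]) blast
    define D where "D x = (SOME D. D \<in> \<D> \<and> x \<in> D \<and> D \<subseteq> d x)" for x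
    have "D x \<in> \<D> \<and> x \<in> D x \<and> D x \<subseteq> d x" if "x \<in> A" for x
      unfolding D_def by (rule someI_ex) (use base[OF d(1)[OF that] d(2)[OF that]] in blast)
    then have D: "\<And>x. x \<in> A \<Longrightarrow> D x \<in> \<D>" "\<And>x. x \<in> A \<Longrightarrow> x \<in> D x" "\<And>x. x \<in> A \<Longrightarrow> D x \<subseteq> d x"
      by simp_all
    have dj: "D x \<inter> D y = {}" if "x \<in> A" "y \<in> A" "x \<noteq> y" for x y
    proof -
      have "d x \<inter> d y = {}" using d(3) that unfolding disjoint_family_on_def by blast
      then show ?thesis using D(3)[of x] D(3)[of y] that by blast
    qed
    have inj: "inj_on D A"
    proof (rule inj_onI, rule ccontr)
      fix x y assume "x \<in> A" "y \<in> A" "D x = D y" "x \<noteq> y"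
      then show False using dj[of x y] D(2)[of x] by simp
    qed
    have I: "D ` A \<in> ?I"
      using A(1) D(1) dj by (auto simp: disjoint_def pairwise_def disjnt_def)
    have "{E\<in>D ` A. Q \<inter> E \<noteq> {}} = D ` A" using A D(2) by blast
    then have "?f (D ` A) = (of_nat (card A) :: ennreal)" using inj by (simp add: card_image)
    then show ?thesis using SUP_upper[OF I, of "\<lambda>\<F>. ?f \<F> :: ennreal"] by simp
  qed
  show "emeasure (count_space UNIV) Q \<le> (SUP \<F>\<in>?I. ?f \<F>)"
  proof (cases "finite Q")
    case True then show ?thesis using le by simp
  next
    case False
    define s :: ennreal where "s = (SUP \<F>\<in>?I. ?f \<F>)"
    have "of_nat n \<le> s" for n
      using infinite_arbitrarily_large[OF False, of n] le unfolding s_def by auto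
    note n = this
    have "\<not> s < top"
    proof
      assume "s < top"
      then obtain n where "s < of_nat n" using ennreal_Ex_less_of_nat by blast
      with n[of n] show False by (simp add: not_le[symmetric])
    qed
    then show ?thesis unfolding s_def[symmetric] by (simp add: less_top[symmetric])
  qed
  show "(SUP \<F>\<in>?I. ?f \<F>) \<le> emeasure (count_space UNIV) Q"
  proof (rule SUP_least)
    fix \<F> assume F: "\<F> \<in> ?I"
    show "?f \<F> \<le> emeasure (count_space UNIV) Q"
    proof (cases "finite Q")
      case True
      define x where "x D = (SOME x. x \<in> Q \<and> x \<in> D)" for D
      have x: "x D \<in> Q \<and> x D \<in> D" if "Q \<inter> D \<noteq> {}" for D
        unfolding x_def by (rule someI_ex) (use that in blast)
      have "inj_on x {D\<in>\<F>. Q \<inter> D \<noteq> {}}"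
      proof (rule inj_onI)
        fix D E assume DE: "D \<in> {D\<in>\<F>. Q \<inter> D \<noteq> {}}" "E \<in> {D\<in>\<F>. Q \<inter> D \<noteq> {}}" "x D = x E"
        then have "x D \<in> D \<inter> E" using x[of D] x[of E] by auto
        then show "D = E" using F DE by (auto dest: disjointD)
      qed
      then have "card {D\<in>\<F>. Q \<inter> D \<noteq> {}} \<le> card Q"
        using x by (intro card_inj_on_le[OF _ _ True]) auto
      then show ?thesis using True by simp
    qed simp
  qed
qed

text \<open>A countable base has only countably many finite subfamilies, so the count is a countable
  supremum of finite sums of indicators of hitting events. Used both for points in the group and for
  cosets in the quotient.\<close>

lemma count_measurable:
  assumes X: "Hausdorff_space X" and Q: "\<And>P. P \<in> space M \<Longrightarrow> Q P \<subseteq> topspace X"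
    and base: "\<And>U x. openin X U \<Longrightarrow> x \<in> U \<Longrightarrow> \<exists>D\<in>\<D>. x \<in> D \<and> D \<subseteq> U" and "countable \<D>"
    and meas: "\<And>D. D \<in> \<D> \<Longrightarrow> {P\<in>space M. Q P \<inter> D \<noteq> {}} \<in> sets M"
  shows "(\<lambda>P. emeasure (count_space UNIV) (Q P)) \<in> borel_measurable M"
proof -
  let ?I = "{\<F>. finite \<F> \<and> \<F> \<subseteq> \<D> \<and> disjoint \<F>}"
  have cI: "countable ?I"
    by (rule countable_subset[OF _ countable_Collect_finite_subset[OF \<open>countable \<D>\<close>]]) auto
  have eq: "emeasure (count_space UNIV) (Q P) =
     (SUP \<F>\<in>?I. \<Sum>D\<in>\<F>. indicator {P\<in>space M. Q P \<inter> D \<noteq> {}} P)" if P: "P \<in> space M" for P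
  proof (rule trans[OF count_eq_SUP_disjoint[OF X Q[OF P] base]], assumption, assumption, rule SUP_cong[OF refl])
    fix \<F> assume "\<F> \<in> ?I"
    then have "finite \<F>" by simp
    then show "of_nat (card {D\<in>\<F>. Q P \<inter> D \<noteq> {}}) = (\<Sum>D\<in>\<F>. indicator {P\<in>space M. Q P \<inter> D \<noteq> {}} P :: ennreal)"
      using P by (simp add: indicator_def sum.If_cases Int_def)
  qed
  have "(\<lambda>P. SUP \<F>\<in>?I. \<Sum>D\<in>\<F>. indicator {P\<in>space M. Q P \<inter> D \<noteq> {}} P :: ennreal) \<in> borel_measurable M"
  proof (rule borel_measurable_SUP[OF cI])
    fix \<F> assume "\<F> \<in> ?I"
    then show "(\<lambda>P. \<Sum>D\<in>\<F>. indicator {P\<in>space M. Q P \<inter> D \<noteq> {}} P :: ennreal) \<in> borel_measurable M"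
      using meas by (intro borel_measurable_sum borel_measurable_indicator) auto
  qed
  then show ?thesis by (subst measurable_cong[OF eq])
qed

subsection \<open>Hulls\<close>

lemma act_eq: "act g P = {x. x + g \<in> P}"
  unfolding act_def by (auto intro!: image_eqI[of _ _ "_ + g"])

lemma act_act: "act g (act h P) = act (g + h) P"
  by (simp add: act_eq add.assoc)

lemma act_0 [simp]: "act 0 P = P"
  by (simp add: act_eq)

lemma act_Int_empty: "act g P \<inter> A = {} \<longleftrightarrow> P \<inter> {x. x - g \<in> A} = {}"
proof -
  have "x \<in> A \<and> x + g \<in> P \<Longrightarrow> x + g - g \<in> A \<and> x + g \<in> P" for x by simp
  then show ?thesis unfolding act_eq by fastforce
qed

lemma closed_act:
  fixes P :: "'a::topological_group_add set"
  assumes "closed P" shows "closed (act g P)"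
proof -
  have "closed ((\<lambda>x. x + g) -` P)" by (intro closed_vimage assms continuous_intros)
  then show ?thesis by (simp add: act_eq vimage_def)
qed

lemma closed_act_iff: "closed (act g P) \<longleftrightarrow> closed P"
  for P :: "'a::topological_group_add set"
proof
  assume "closed (act g P)"
  then have "closed (act (- g) (act g P))" by (rule closed_act)
  also have "act (- g) (act g P) = P" by (simp add: act_act)
  finally show "closed P" .
qed (rule closed_act)

lemma openin_miss_compact: "compact C \<Longrightarrow> openin chabauty_fell {P. closed P \<and> P \<inter> C = {}}"
  unfolding chabauty_fell_def by (rule topology_generated_by_Basis) blast

lemma openin_hit_open: "open U \<Longrightarrow> openin chabauty_fell {P. closed P \<and> P \<inter> U \<noteq> {}}"
  unfolding chabauty_fell_def by (rule topology_generated_by_Basis) blast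

lemma topspace_chabauty_fell: "topspace chabauty_fell = {P. closed P}"
proof
  show "topspace chabauty_fell \<subseteq> {P. closed P}"
    unfolding chabauty_fell_def topology_generated_by_topspace by blast
  show "{P. closed P} \<subseteq> topspace chabauty_fell"
    using openin_subset[OF openin_miss_compact[OF compact_empty]] by simp
qed

lemma continuous_map_act:
  fixes g :: "'a::{topological_group_add, t2_space}"
  shows "continuous_map chabauty_fell chabauty_fell (act g)"
proof -
  let ?S = "{{P. closed P \<and> P \<inter> C = {}} | C. compact C} \<union> {{P. closed P \<and> P \<inter> U \<noteq> {}} | U. open (U :: 'a set)}"
  have "continuous_map chabauty_fell (topology_generated_by ?S) (act g)"
  proof (rule continuous_on_generated_topo)
    fix \<U> assume "\<U> \<in> ?S"
    then consider C where "compact C" "\<U> = {P. closed P \<and> P \<inter> C = {}}"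
      | U where "open U" "\<U> = {P. closed P \<and> P \<inter> U \<noteq> {}}" by blast
    then show "openin chabauty_fell (act g -` \<U> \<inter> topspace chabauty_fell)"
    proof cases
      case 1
      have "{x. x - g \<in> C} = (\<lambda>x. x + g) ` C" by (auto intro!: image_eqI[of _ _ "_ - g"])
      moreover have "compact ((\<lambda>x. x + g) ` C)" by (intro compact_continuous_image continuous_intros 1)
      moreover have "act g -` \<U> \<inter> topspace chabauty_fell = {P. closed P \<and> P \<inter> {x. x - g \<in> C} = {}}"
        by (auto simp: 1 topspace_chabauty_fell closed_act_iff act_Int_empty)
      ultimately show ?thesis using openin_miss_compact[of "{x. x - g \<in> C}"] by simp
    next
      case 2
      have "open ((\<lambda>x. x - g) -` U)" by (intro open_vimage 2 continuous_intros)
      then have "open {x. x - g \<in> U}" by (simp add: vimage_def)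
      moreover have "act g -` \<U> \<inter> topspace chabauty_fell = {P. closed P \<and> P \<inter> {x. x - g \<in> U} \<noteq> {}}"
        by (auto simp: 2 topspace_chabauty_fell closed_act_iff act_Int_empty)
      ultimately show ?thesis using openin_hit_open[of "{x. x - g \<in> U}"] by simp
    qed
  next
    have "\<Union>?S = topspace chabauty_fell" unfolding chabauty_fell_def topology_generated_by_topspace ..
    then show "act g ` topspace chabauty_fell \<subseteq> \<Union>?S" by (auto simp: topspace_chabauty_fell closed_act)
  qed
  then show ?thesis by (simp add: chabauty_fell_def)
qed

lemma act_orbit_hull:
  fixes P :: "'a::{topological_group_add, t2_space} set"
  assumes "P \<in> orbit_hull P\<^sub>o" shows "act g P \<in> orbit_hull P\<^sub>o"
proof -
  let ?R = "range (\<lambda>g. act g P\<^sub>o)"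
  have "P \<in> chabauty_fell closure_of ?R" "P \<noteq> {}"
    using assms by (simp_all add: orbit_hull_def extended_orbit_hull_def)
  then have "act g P \<in> chabauty_fell closure_of (act g ` ?R)" "act g P \<noteq> {}"
    using continuous_map_image_closure_subset[OF continuous_map_act[of g], of ?R]
    by (simp_all add: image_subset_iff act_def)
  moreover have "act g ` ?R \<subseteq> ?R" by (auto simp: act_act)
  from closure_of_mono[OF this, of chabauty_fell]
  have "chabauty_fell closure_of (act g ` ?R) \<subseteq> chabauty_fell closure_of ?R" .
  ultimately show ?thesis
    by (simp add: orbit_hull_def extended_orbit_hull_def subset_iff)
qed

lemma closed_orbit_hull:
  assumes "P \<in> orbit_hull P\<^sub>o" shows "closed P"
proof -
  have "P \<in> chabauty_fell closure_of (range (\<lambda>g. act g P\<^sub>o))"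
    using assms by (simp add: orbit_hull_def extended_orbit_hull_def)
  from subsetD[OF closure_of_subset_topspace this] show ?thesis by (simp add: topspace_chabauty_fell)
qed

text \<open>Hitting two given open sets is an open condition on closed sets, so points of the orbit
  of \<open>P\<^sub>o\<close> approximate \<open>p\<close> and \<open>q\<close> simultaneously.
  Right translation leaves differences unchanged, hence the whole orbit has the difference set of
  \<open>P\<^sub>o\<close>.\<close>

lemma orbit_hull_differences:
  fixes P :: "'a::{topological_group_add, t2_space} set"
  assumes P: "P \<in> orbit_hull P\<^sub>o" and pq: "p \<in> P" "q \<in> P"
  shows "p - q \<in> closure {x - y | x y. x \<in> P\<^sub>o \<and> y \<in> P\<^sub>o}" (is "_ \<in> closure ?D")
proof (rule ccontr)
  assume n: "p - q \<notin> closure ?D"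
  have "open ((\<lambda>z. fst z - snd z) -` (- closure ?D))" by (intro open_vimage continuous_intros) auto
  moreover have "(p, q) \<in> (\<lambda>z. fst z - snd z) -` (- closure ?D)" using n by simp
  ultimately obtain U V where UV: "open U" "open V" "(p, q) \<in> U \<times> V"
      "U \<times> V \<subseteq> (\<lambda>z. fst z - snd z) -` (- closure ?D)"
    by (rule open_prod_elim)
  define \<U> where "\<U> = {P. closed P \<and> P \<inter> U \<noteq> {}} \<inter> {P. closed P \<and> P \<inter> V \<noteq> {}}"
  have "openin chabauty_fell \<U>" unfolding \<U>_def using UV by (intro openin_Int openin_hit_open)
  moreover have "P \<in> \<U>" using pq UV closed_orbit_hull[OF P] by (auto simp: \<U>_def)
  moreover have "P \<in> chabauty_fell closure_of range (\<lambda>g. act g P\<^sub>o)"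
    using P by (simp add: orbit_hull_def extended_orbit_hull_def)
  ultimately have "\<exists>Q. Q \<in> range (\<lambda>g. act g P\<^sub>o) \<and> Q \<in> \<U>" by (simp add: in_closure_of)
  then obtain g where "act g P\<^sub>o \<in> \<U>" by (elim exE conjE rangeE) simp
  then obtain x y where xy: "x \<in> U" "y \<in> V" "x + g \<in> P\<^sub>o" "y + g \<in> P\<^sub>o" by (auto simp: \<U>_def act_eq)
  have "x - y = (x + g) - (y + g)" by (simp add: diff_add_eq_diff_diff_swap)
  then have "x - y \<in> ?D" unfolding mem_Collect_eq using xy(3,4) by (intro exI conjI)
  then have "x - y \<in> closure ?D" by (rule subsetD[OF closure_subset])
  moreover have "x - y \<notin> closure ?D" using UV(4) xy by auto
  ultimately show False by simp
qed

lemma Hausdorff_space_euclidean_t2: "Hausdorff_space (euclidean :: 'a::t2_space topology)"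
  unfolding Hausdorff_space_def disjnt_def
proof (intro allI impI)
  fix x y :: 'a assume "x \<in> topspace euclidean \<and> y \<in> topspace euclidean \<and> x \<noteq> y"
  then show "\<exists>U V. openin euclidean U \<and> openin euclidean V \<and> x \<in> U \<and> y \<in> V \<and> U \<inter> V = {}"
    using hausdorff[of x y] by simp
qed

lemma
  assumes "invariant_hull_measure P\<^sub>o \<mu>"
  shows space_hull_measure: "space \<mu> = orbit_hull P\<^sub>o"
    and sets_hull_measure: "sets \<mu> = sigma_sets (orbit_hull P\<^sub>o) {U. openin (subtopology chabauty_fell (orbit_hull P\<^sub>o)) U}"
proof -
  let ?T = "subtopology chabauty_fell (orbit_hull P\<^sub>o)"
  have top: "topspace ?T = orbit_hull P\<^sub>o"
    using closed_orbit_hull by (auto simp: topspace_chabauty_fell)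
  have 1: "sets \<mu> = sets (borel_of_topology ?T)" using assms by (simp add: invariant_hull_measure_def)
  have 2: "{U. openin ?T U} \<subseteq> Pow (topspace ?T)" using openin_subset by blast
  show "space \<mu> = orbit_hull P\<^sub>o"
    using sets_eq_imp_space_eq[OF 1] space_measure_of[OF 2] top by (simp add: borel_of_topology_def)
  show "sets \<mu> = sigma_sets (orbit_hull P\<^sub>o) {U. openin ?T U}"
    using 1 sets_measure_of[OF 2] top by (simp add: borel_of_topology_def)
qed

lemma hull_measure_openin:
  assumes "invariant_hull_measure P\<^sub>o \<mu>" "openin chabauty_fell \<U>"
  shows "\<U> \<inter> space \<mu> \<in> sets \<mu>"
  unfolding sets_hull_measure[OF assms(1)] space_hull_measure[OF assms(1)]
  using assms(2) by (intro sigma_sets.Basic) (auto simp: openin_subtopology)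

lemma hit_open_sets:
  assumes "invariant_hull_measure P\<^sub>o \<mu>" "open U"
  shows "{P\<in>space \<mu>. P \<inter> U \<noteq> {}} \<in> sets \<mu>"
proof -
  have "{P\<in>space \<mu>. P \<inter> U \<noteq> {}} = {P. closed P \<and> P \<inter> U \<noteq> {}} \<inter> space \<mu>"
    using closed_orbit_hull by (auto simp: space_hull_measure[OF assms(1)])
  then show ?thesis using hull_measure_openin[OF assms(1) openin_hit_open[OF assms(2)]] by simp
qed

lemma hit_compact_sets:
  assumes "invariant_hull_measure P\<^sub>o \<mu>" "compact C"
  shows "{P\<in>space \<mu>. P \<inter> C \<noteq> {}} \<in> sets \<mu>"
proof -
  have "{P\<in>space \<mu>. P \<inter> C \<noteq> {}} = space \<mu> - {P. closed P \<and> P \<inter> C = {}} \<inter> space \<mu>"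
    using closed_orbit_hull by (auto simp: space_hull_measure[OF assms(1)])
  then show ?thesis using hull_measure_openin[OF assms(1) openin_miss_compact[OF assms(2)]] by auto
qed

lemma act_measurable:
  fixes \<mu> :: "'a::{topological_group_add, t2_space} set measure"
  assumes "invariant_hull_measure P\<^sub>o \<mu>"
  shows "act g \<in> measurable \<mu> \<mu>"
proof (rule measurable_sigma_sets[OF sets_hull_measure[OF assms]])
  show "{U. openin (subtopology chabauty_fell (orbit_hull P\<^sub>o)) U} \<subseteq> Pow (orbit_hull P\<^sub>o)"
    by (auto simp: openin_subtopology)
  show "act g \<in> space \<mu> \<rightarrow> orbit_hull P\<^sub>o" by (auto simp: space_hull_measure[OF assms] act_orbit_hull)
  fix U assume "U \<in> {U. openin (subtopology chabauty_fell (orbit_hull P\<^sub>o)) U}"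
  then obtain W where W: "openin chabauty_fell W" "U = W \<inter> orbit_hull P\<^sub>o" by (auto simp: openin_subtopology)
  have "openin chabauty_fell {P \<in> topspace chabauty_fell. act g P \<in> W}"
    by (rule openin_continuous_map_preimage[OF continuous_map_act W(1)])
  moreover have "act g -` U \<inter> space \<mu> = {P \<in> topspace chabauty_fell. act g P \<in> W} \<inter> space \<mu>"
    using act_orbit_hull closed_orbit_hull
    by (auto simp: W(2) space_hull_measure[OF assms] topspace_chabauty_fell)
  ultimately show "act g -` U \<inter> space \<mu> \<in> sets \<mu>" using hull_measure_openin[OF assms] by simp
qed

lemma distr_act:
  fixes \<mu> :: "'a::{topological_group_add, t2_space} set measure"
  assumes "invariant_hull_measure P\<^sub>o \<mu>"
  shows "distr \<mu> \<mu> (act g) = \<mu>"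
proof (rule measure_eqI)
  fix A assume "A \<in> sets (distr \<mu> \<mu> (act g))"
  then have A: "A \<in> sets \<mu>" by simp
  then have "A \<subseteq> orbit_hull P\<^sub>o" using sets.sets_into_space space_hull_measure[OF assms] by blast
  \<comment> \<open>Invariance is given for images, while \<open>distr\<close> is evaluated on
    preimages; \<open>act (- g)\<close> inverts \<open>act g\<close> and preserves the hull.\<close>
  have "act g -` A \<inter> space \<mu> = act (- g) ` A"
  proof (intro equalityI subsetI)
    fix P assume "P \<in> act g -` A \<inter> space \<mu>"
    then show "P \<in> act (- g) ` A" by (intro image_eqI[of _ _ "act g P"]) (auto simp: act_act)
  next
    fix P assume "P \<in> act (- g) ` A"
    then obtain Q where Q: "Q \<in> A" "P = act (- g) Q" by blast
    then have "act g P = Q" by (simp add: act_act)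
    then show "P \<in> act g -` A \<inter> space \<mu>"
      using Q \<open>A \<subseteq> orbit_hull P\<^sub>o\<close> act_orbit_hull[of Q P\<^sub>o "- g"]
      by (auto simp: space_hull_measure[OF assms])
  qed
  then have "emeasure (distr \<mu> \<mu> (act g)) A = emeasure \<mu> (act (- g) ` A)"
    using emeasure_distr[OF act_measurable[OF assms] A] by simp
  also have "\<dots> = emeasure \<mu> A" using assms A by (simp add: invariant_hull_measure_def)
  finally show "emeasure (distr \<mu> \<mu> (act g)) A = emeasure \<mu> A" .
qed simp

subsection \<open>The intensity measure of the enlarged point process\<close>

text \<open>The assumption \<open>sep\<close> is the uniform density bound: every right translate of
  \<open>V\<close> contains at most one point of \<Gamma> + P, with the same \<open>V\<close> for
  the whole hull.\<close>

locale hull_process =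
  fixes P\<^sub>o :: "'a::{topological_group_add, t2_space, second_countable_topology} set"
    and \<mu> :: "'a set measure" and \<Gamma> V :: "'a set"
  assumes inv: "invariant_hull_measure P\<^sub>o \<mu>"
    and countable: "countable \<Gamma>"
    and V: "open V" "0 \<in> V"
    and sep: "\<And>P x y g. P \<in> orbit_hull P\<^sub>o \<Longrightarrow> x \<in> \<Gamma> + P \<Longrightarrow> y \<in> \<Gamma> + P \<Longrightarrow>
                x - g \<in> V \<Longrightarrow> y - g \<in> V \<Longrightarrow> x = y"
begin

text \<open>Points of the set are counted, not representations: coinciding sums \<gamma> + p count
  once. This is what makes the count at most 1 on a tile.\<close>

definition num :: "'a set \<Rightarrow> 'a set \<Rightarrow> ennreal" where
  "num P B = emeasure (count_space UNIV) ((\<Gamma> + P) \<inter> B)"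

definition tile :: "'a \<Rightarrow> 'a set" where
  "tile g = {x. x - g \<in> V}"

lemma open_tile: "open (tile g)"
proof -
  have "open ((\<lambda>x. x - g) -` V)" by (intro open_vimage V continuous_intros)
  then show ?thesis by (simp add: tile_def vimage_def)
qed

lemma mem_tile: "g \<in> tile g" using V by (simp add: tile_def)

lemma num_tile_le:
  assumes P: "P \<in> orbit_hull P\<^sub>o" and B: "B \<subseteq> tile g" shows "num P B \<le> 1"
proof -
  have "(\<Gamma> + P) \<inter> B = {} \<or> (\<exists>x. (\<Gamma> + P) \<inter> B = {x})"
  proof (rule disjCI)
    assume "\<nexists>x. (\<Gamma> + P) \<inter> B = {x}"
    moreover have "(\<Gamma> + P) \<inter> B = {x}" if "x \<in> (\<Gamma> + P) \<inter> B" for x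
      using that B sep[OF P, of x _ g] unfolding tile_def by blast
    ultimately show "(\<Gamma> + P) \<inter> B = {}" by blast
  qed
  then show ?thesis unfolding num_def by (elim disjE exE) simp_all
qed

lemma suminf_num: "disjoint_family A \<Longrightarrow> (\<Sum>i. num P (A i)) = num P (\<Union>i. A i)"
  unfolding num_def by (subst suminf_emeasure) (auto simp: disjoint_family_on_def intro!: arg_cong[of _ _ "emeasure _"])

lemma num_open_measurable:
  assumes W: "open W" shows "(\<lambda>P. num P W) \<in> borel_measurable \<mu>"
proof -
  obtain \<D> :: "'a set set" where D: "countable \<D>" "topological_basis \<D>" using ex_countable_basis by blast
  show ?thesis unfolding num_def
  proof (rule count_measurable[OF Hausdorff_space_euclidean_t2, where \<D>=\<D>])
    show "countable \<D>" by fact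
    show "\<exists>D\<in>\<D>. x \<in> D \<and> D \<subseteq> U" if "openin euclidean U" "x \<in> U" for U and x :: 'a
      using topological_basisE[OF D(2), of U x] that by (metis open_openin)
    fix D assume "D \<in> \<D>"
    then have o: "open (W \<inter> D)" using topological_basis_open[OF D(2)] W by auto
    \<comment> \<open>The available events concern \<open>P\<close> itself, not \<Gamma> + P.
      Countability of \<Gamma> reduces the hitting event to a countable union of events for
      \<open>P\<close>.\<close>
    have "{P\<in>space \<mu>. (\<Gamma> + P) \<inter> W \<inter> D \<noteq> {}} = (\<Union>\<gamma>\<in>\<Gamma>. {P\<in>space \<mu>. P \<inter> {x. \<gamma> + x \<in> W \<inter> D} \<noteq> {}})"
      by (auto simp: set_plus_def)
    also have "\<dots> \<in> sets \<mu>"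
    proof (rule sets.countable_UN''[OF countable])
      fix \<gamma> assume "\<gamma> \<in> \<Gamma>"
      have "open ((\<lambda>x. \<gamma> + x) -` (W \<inter> D))" by (intro open_vimage o continuous_intros)
      then have "open {x. \<gamma> + x \<in> W \<inter> D}" by (simp add: vimage_def)
      then show "{P\<in>space \<mu>. P \<inter> {x. \<gamma> + x \<in> W \<inter> D} \<noteq> {}} \<in> sets \<mu>" by (rule hit_open_sets[OF inv])
    qed
    finally show "{P\<in>space \<mu>. (\<Gamma> + P) \<inter> W \<inter> D \<noteq> {}} \<in> sets \<mu>" .
  qed auto
qed

text \<open>A Dynkin argument starting from open sets. Cutting down to one tile keeps the counts at
  most 1, so that complements can be handled by subtraction without meeting infinity minus
  infinity.\<close>

lemma num_Int_tile_measurable: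
  assumes "B \<in> sets borel" shows "(\<lambda>P. num P (B \<inter> tile g)) \<in> borel_measurable \<mu>"
proof -
  have "Int_stable {S :: 'a set. open S}" by (auto simp: Int_stable_def)
  moreover have "{S :: 'a set. open S} \<subseteq> Pow UNIV" by simp
  moreover have "B \<in> sigma_sets UNIV {S. open S}" using assms by (simp add: borel_def)
  ultimately show ?thesis
  proof (induction rule: sigma_sets_induct_disjoint)
    case (basic A)
    then show ?case using open_tile by (intro num_open_measurable open_Int) auto
  next
    case empty
    then show ?case by (simp add: num_def)
  next
    case (compl A)
    have eq: "num P ((UNIV - A) \<inter> tile g) = num P (tile g) - num P (A \<inter> tile g)" if "P \<in> space \<mu>" for P
    proof -
      have "num P (A \<inter> tile g) \<le> 1" using that num_tile_le[of P "A \<inter> tile g" g]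
        by (simp add: space_hull_measure[OF inv])
      then have "num P (A \<inter> tile g) \<noteq> \<infinity>" by (auto simp: top_unique)
      then have "num P (tile g - A \<inter> tile g) = num P (tile g) - num P (A \<inter> tile g)"
        unfolding num_def Diff_Int_distrib by (intro emeasure_Diff) auto
      moreover have "(UNIV - A) \<inter> tile g = tile g - A \<inter> tile g" by blast
      ultimately show ?thesis by simp
    qed
    have "(\<lambda>P. num P (tile g) - num P (A \<inter> tile g)) \<in> borel_measurable \<mu>"
      using compl.IH num_open_measurable[OF open_tile] by (intro borel_measurable_minus_ennreal)
    then show ?case by (subst measurable_cong[OF eq])
  next
    case (union A)
    have "num P ((\<Union>i. A i) \<inter> tile g) = (\<Sum>i. num P (A i \<inter> tile g))" for P
    proof -
      have "(\<Union>i. A i) \<inter> tile g = (\<Union>i. A i \<inter> tile g)" by blast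
      moreover have "disjoint_family (\<lambda>i. A i \<inter> tile g)"
        using union(1) unfolding disjoint_family_on_def by blast
      ultimately show ?thesis by (simp add: suminf_num)
    qed
    then show ?case using union(3) by simp
  qed
qed

lemma tiles_cover: obtains c :: "nat \<Rightarrow> 'a" where "(\<Union>i. tile (c i)) = UNIV"
proof -
  obtain \<F>' where F: "\<F>' \<subseteq> range tile" "countable \<F>'" "\<Union>\<F>' = \<Union>(range tile)"
    using Lindelof[of "range tile"] open_tile by auto
  then have U: "\<Union>\<F>' = UNIV" using mem_tile by auto
  then have ne: "\<F>' \<noteq> {}" by auto
  define c where "c i = (SOME g. tile g = from_nat_into \<F>' i)" for i
  have "tile (c i) = from_nat_into \<F>' i" for i
    unfolding c_def by (rule someI_ex) (use subsetD[OF F(1) from_nat_into[OF ne, of i]] in \<open>elim imageE, metis\<close>)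
  then have "(\<Union>i. tile (c i)) = \<Union>(range (from_nat_into \<F>'))" by simp
  also have "\<dots> = UNIV" using range_from_nat_into[OF ne F(2)] U by simp
  finally show thesis by (rule that)
qed

text \<open>Countably many tiles cover the group; making them disjoint writes the count as a
  countable sum of counts within single tiles.\<close>

lemma num_measurable [measurable]:
  assumes "B \<in> sets borel" shows "(\<lambda>P. num P B) \<in> borel_measurable \<mu>"
proof -
  obtain c :: "nat \<Rightarrow> 'a" where c: "(\<Union>i. tile (c i)) = UNIV" by (rule tiles_cover) blast
  define A where "A = disjointed (\<lambda>i. tile (c i))"
  have A: "disjoint_family A" "(\<Union>i. A i) = UNIV" and Ac: "A i \<subseteq> tile (c i)" and Ab: "A i \<in> sets borel" for i
    unfolding A_def
    using c disjoint_family_disjointed UN_disjointed_eq[of "\<lambda>i. tile (c i)"] disjointed_subset[of "\<lambda>i. tile (c i)" i]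
      sets.range_disjointed_sets[of "\<lambda>i. tile (c i)" borel] open_tile by (simp_all add: image_subset_iff)
  have "num P B = (\<Sum>i. num P (B \<inter> A i \<inter> tile (c i)))" for P
  proof -
    have "B \<inter> A i \<inter> tile (c i) = B \<inter> A i" for i using Ac[of i] by blast
    moreover have "(\<Sum>i. num P (B \<inter> A i)) = num P (\<Union>i. B \<inter> A i)"
      using A(1) by (intro suminf_num) (auto simp: disjoint_family_on_def)
    moreover have "(\<Union>i. B \<inter> A i) = B" using A(2) by blast
    ultimately show ?thesis by simp
  qed
  moreover have "(\<lambda>P. num P (B \<inter> A i \<inter> tile (c i))) \<in> borel_measurable \<mu>" for i
    using Ab assms by (intro num_Int_tile_measurable sets.Int)
  ultimately show ?thesis by simp
qed

text \<open>The intensity, or first moment measure, of the random point set \<Gamma> + P when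
  \<open>P\<close> has law \<mu>.\<close>

definition intensity :: "'a measure" where
  "intensity = measure_of UNIV (sets borel) (\<lambda>B. \<integral>\<^sup>+P. num P B \<partial>\<mu>)"

lemma sets_intensity [simp, measurable_cong]: "sets intensity = sets borel"
  unfolding intensity_def by (metis sets.sets_measure_of_eq space_borel)

lemma space_intensity [simp]: "space intensity = UNIV"
  using sets_eq_imp_space_eq[OF sets_intensity] by simp

lemma emeasure_intensity:
  assumes "B \<in> sets borel" shows "emeasure intensity B = (\<integral>\<^sup>+P. num P B \<partial>\<mu>)"
proof (rule emeasure_measure_of[OF intensity_def])
  show "positive (sets intensity) (\<lambda>B. \<integral>\<^sup>+P. num P B \<partial>\<mu>)" by (simp add: positive_def num_def)
  show "countably_additive (sets intensity) (\<lambda>B. \<integral>\<^sup>+P. num P B \<partial>\<mu>)"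
    unfolding countably_additive_def
  proof (intro allI impI)
    fix A :: "nat \<Rightarrow> 'a set" assume A: "range A \<subseteq> sets intensity" "disjoint_family A"
    then have "(\<Sum>i. \<integral>\<^sup>+P. num P (A i) \<partial>\<mu>) = (\<integral>\<^sup>+P. (\<Sum>i. num P (A i)) \<partial>\<mu>)"
      by (intro nn_integral_suminf[symmetric] num_measurable) auto
    then show "(\<Sum>i. \<integral>\<^sup>+P. num P (A i) \<partial>\<mu>) = (\<integral>\<^sup>+P. num P (\<Union>i. A i) \<partial>\<mu>)"
      using A(2) by (simp add: suminf_num)
  qed
qed (use assms in auto)

lemma intensity_tile_le: "emeasure intensity (tile g) \<le> 1"
proof -
  interpret prob_space \<mu> using inv by (simp add: invariant_hull_measure_def)
  have "emeasure intensity (tile g) = (\<integral>\<^sup>+P. num P (tile g) \<partial>\<mu>)"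
    using open_tile by (intro emeasure_intensity) auto
  also have "\<dots> \<le> (\<integral>\<^sup>+P. 1 \<partial>\<mu>)"
    by (intro nn_integral_mono num_tile_le[OF _ order_refl]) (simp add: space_hull_measure[OF inv])
  finally show ?thesis by (simp add: emeasure_space_1)
qed

lemma intensity_compact_finite:
  assumes "compact T" shows "emeasure intensity T < \<infinity>"
proof -
  have "T \<subseteq> (\<Union>g\<in>UNIV. tile g)" using mem_tile by blast
  then obtain C where C: "finite C" "T \<subseteq> (\<Union>g\<in>C. tile g)"
    using compactE_image[OF assms, of UNIV tile] open_tile by metis
  have "emeasure intensity T \<le> emeasure intensity (\<Union>g\<in>C. tile g)"
    using C open_tile by (intro emeasure_mono) auto
  also have "\<dots> \<le> (\<Sum>g\<in>C. emeasure intensity (tile g))"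
    using C open_tile by (intro emeasure_subadditive_finite) auto
  also have "\<dots> \<le> (\<Sum>g\<in>C. 1)" by (intro sum_mono intensity_tile_le)
  also have "\<dots> < \<infinity>" by (simp add: of_nat_less_top)
  finally show ?thesis .
qed

text \<open>\<open>act (- g)\<close> is right translation by \<open>g\<close>. It commutes with
  adding \<Gamma> on the left, so the enlarged process inherits the invariance of the hull
  measure.\<close>

lemma num_act: "num (act (- g) P) B = num P {x. x + g \<in> B}"
proof -
  have "(\<Gamma> + act (- g) P) \<inter> B = (\<lambda>x. x + g) ` ((\<Gamma> + P) \<inter> {x. x + g \<in> B})"
  proof (intro equalityI subsetI)
    fix y assume "y \<in> (\<Gamma> + act (- g) P) \<inter> B"
    then obtain \<gamma> x where x: "y = \<gamma> + x" "\<gamma> \<in> \<Gamma>" "x - g \<in> P" "y \<in> B" by (auto simp: set_plus_def act_eq)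
    then have "y - g = \<gamma> + (x - g)" by (simp add: add_diff_eq)
    then have "y - g \<in> \<Gamma> + P" using x by (auto simp: set_plus_def)
    then show "y \<in> (\<lambda>x. x + g) ` ((\<Gamma> + P) \<inter> {x. x + g \<in> B})" using x by (intro image_eqI[of _ _ "y - g"]) auto
  next
    fix y assume "y \<in> (\<lambda>x. x + g) ` ((\<Gamma> + P) \<inter> {x. x + g \<in> B})"
    then obtain \<gamma> p where p: "y = \<gamma> + p + g" "\<gamma> \<in> \<Gamma>" "p \<in> P" "y \<in> B" by (auto simp: set_plus_def)
    then have "y = \<gamma> + (p + g)" "p + g \<in> act (- g) P" by (simp_all add: add.assoc act_eq)
    then show "y \<in> (\<Gamma> + act (- g) P) \<inter> B" using p by (auto simp: set_plus_def)
  qed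
  moreover have "bij_betw (\<lambda>x. x + g) ((\<Gamma> + P) \<inter> {x. x + g \<in> B}) ((\<lambda>x. x + g) ` ((\<Gamma> + P) \<inter> {x. x + g \<in> B}))"
    by (intro inj_on_imp_bij_betw inj_onI) simp
  ultimately show ?thesis
    unfolding num_def by (simp add: emeasure_count_space bij_betw_finite[symmetric] bij_betw_same_card[symmetric])
qed

lemma intensity_right_invariant: "distr intensity borel (\<lambda>x. x + g) = intensity"
proof (rule measure_eqI)
  fix B assume "B \<in> sets (distr intensity borel (\<lambda>x. x + g))"
  then have B: "B \<in> sets borel" by simp
  have T: "(\<lambda>x. x + g) \<in> borel_measurable borel"
    by (intro borel_measurable_continuous_onI continuous_intros)
  then have T': "(\<lambda>x. x + g) \<in> borel_measurable intensity" by simp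
  have B': "{x. x + g \<in> B} \<in> sets borel" using measurable_sets[OF T B] by (simp add: vimage_def)
  have "emeasure (distr intensity borel (\<lambda>x. x + g)) B = emeasure intensity {x. x + g \<in> B}"
    using emeasure_distr[OF T' B] by (simp add: vimage_def)
  also have "\<dots> = (\<integral>\<^sup>+P. num (act (- g) P) B \<partial>\<mu>)" by (simp add: emeasure_intensity[OF B'] num_act)
  also have "\<dots> = (\<integral>\<^sup>+P. num P B \<partial>\<mu>)"
    by (rule nn_integral_invariant[OF distr_act[OF inv] act_measurable[OF inv] num_measurable[OF B]])
  finally show "emeasure (distr intensity borel (\<lambda>x. x + g)) B = emeasure intensity B"
    using emeasure_intensity[OF B] by simp
qed simp

text \<open>Campbell's formula, by induction on measurable functions. Measurability of the inner sum
  is part of the claim because the additive and the monotone steps need it from the induction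
  hypothesis.\<close>

lemma nn_integral_intensity:
  assumes "\<phi> \<in> borel_measurable borel"
  shows "(\<lambda>P. \<integral>\<^sup>+y. \<phi> y * indicator (\<Gamma> + P) y \<partial>count_space UNIV) \<in> borel_measurable \<mu>
    \<and> (\<integral>\<^sup>+y. \<phi> y \<partial>intensity) = (\<integral>\<^sup>+P. \<integral>\<^sup>+y. \<phi> y * indicator (\<Gamma> + P) y \<partial>count_space UNIV \<partial>\<mu>)"
  using assms
proof (induction rule: borel_measurable_induct)
  case (cong f g)
  then have "f = g" by (auto simp: fun_eq_iff)
  then show ?case using cong by simp
next
  case (set A)
  have "(\<integral>\<^sup>+y. indicator A y * indicator (\<Gamma> + P) y \<partial>count_space UNIV) = num P A" for P
  proof -
    have "indicator A y * indicator (\<Gamma> + P) y = (indicator ((\<Gamma> + P) \<inter> A) y :: ennreal)" for y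
      by (auto simp: indicator_def)
    then show ?thesis by (simp add: num_def)
  qed
  then show ?case using set by (simp add: num_measurable emeasure_intensity)
next
  case (mult u c)
  then show ?case by (simp add: mult.assoc nn_integral_cmult borel_measurable_times_ennreal)
next
  case (add u v)
  have "(\<integral>\<^sup>+y. (v y + u y) * indicator (\<Gamma> + P) y \<partial>count_space UNIV) =
    (\<integral>\<^sup>+y. v y * indicator (\<Gamma> + P) y \<partial>count_space UNIV) + (\<integral>\<^sup>+y. u y * indicator (\<Gamma> + P) y \<partial>count_space UNIV)" for P
    by (subst nn_integral_add[symmetric]) (auto simp: distrib_right)
  then show ?case using add by (simp add: nn_integral_add borel_measurable_add)
next
  case (seq U)
  let ?I = "\<lambda>i P. \<integral>\<^sup>+y. U i y * indicator (\<Gamma> + P) y \<partial>count_space UNIV"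
  have mono: "incseq (\<lambda>i y. U i y * indicator (\<Gamma> + P) y)" for P
    using \<open>incseq U\<close> by (auto simp: incseq_def le_fun_def intro: mult_right_mono)
  have eq: "(\<integral>\<^sup>+y. (SUP i. U i) y * indicator (\<Gamma> + P) y \<partial>count_space UNIV) = (SUP i. ?I i P)" for P
  proof -
    have "(SUP i. U i) y * indicator (\<Gamma> + P) y = (SUP i. U i y * indicator (\<Gamma> + P) y)" for y
      by (simp add: SUP_apply SUP_mult_right_ennreal image_comp)
    then show ?thesis
      using nn_integral_monotone_convergence_SUP[OF mono[of P], of "count_space UNIV"] by simp
  qed
  have I: "?I i \<in> borel_measurable \<mu>" "(\<integral>\<^sup>+y. U i y \<partial>intensity) = (\<integral>\<^sup>+P. ?I i P \<partial>\<mu>)" for i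
    using seq.IH[of i] by auto
  have incI: "incseq ?I"
    using mono by (auto simp: incseq_def le_fun_def intro!: nn_integral_mono)
  have "(\<integral>\<^sup>+y. (SUP i. U i) y \<partial>intensity) = (SUP i. \<integral>\<^sup>+y. U i y \<partial>intensity)"
    using nn_integral_monotone_convergence_SUP[OF \<open>incseq U\<close>, of intensity] seq.hyps(1)
    by (simp add: SUP_apply image_comp)
  also have "\<dots> = (\<integral>\<^sup>+P. (SUP i. ?I i P) \<partial>\<mu>)"
    using nn_integral_monotone_convergence_SUP[OF incI I(1)] I(2) by simp
  finally show ?case unfolding eq using I(1) by simp
qed

end

lemma countable_discrete:
  fixes A :: "'a::second_countable_topology set"
  assumes "discrete A" shows "countable A"
proof -
  obtain \<D> :: "'a set set" where D: "countable \<D>" "topological_basis \<D>" using ex_countable_basis by blast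
  define f where "f x = (SOME D. D \<in> \<D> \<and> D \<inter> A = {x})" for x
  have f: "f x \<in> \<D> \<and> f x \<inter> A = {x}" if x: "x \<in> A" for x
    unfolding f_def
  proof (rule someI_ex)
    have "x isolated_in A" using assms x by (simp add: discrete_def)
    then obtain U where U: "open U" "U \<inter> A = {x}" unfolding isolated_in_def by (elim conjE exE)
    have "x \<in> U \<inter> A" by (simp only: U(2) singletonI)
    then have "x \<in> U" by (rule IntD1)
    from topological_basisE[OF D(2) U(1) this] obtain D' where "D' \<in> \<D>" "x \<in> D'" "D' \<subseteq> U" .
    have "D' \<inter> A \<subseteq> {x}" unfolding U(2)[symmetric] by (intro Int_mono \<open>D' \<subseteq> U\<close> order_refl)
    moreover have "{x} \<subseteq> D' \<inter> A" using \<open>x \<in> D'\<close> x by simp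
    ultimately show "\<exists>D. D \<in> \<D> \<and> D \<inter> A = {x}"
      using \<open>D' \<in> \<D>\<close> by (intro exI[of _ D'] conjI subset_antisym)
  qed
  have "f ` A \<subseteq> \<D>" by (rule image_subsetI) (rule f[THEN conjunct1])
  then have "countable (f ` A)" by (rule countable_subset) (rule D(1))
  moreover have "inj_on f A"
  proof (rule inj_onI)
    fix x y assume xy: "x \<in> A" "y \<in> A" "f x = f y"
    have "f x \<inter> A = {x}" by (rule f[THEN conjunct2, OF xy(1)])
    moreover have "f y \<inter> A = {y}" by (rule f[THEN conjunct2, OF xy(2)])
    ultimately have "{x} = {y}" unfolding xy(3) by (rule trans[OF sym])
    then show "x = y" by (rule singleton_inject)
  qed
  ultimately show ?thesis by (rule countable_image_inj_on)
qed

subsection \<open>The space of right cosets\<close>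

lemma right_coset_eq_iff:
  assumes "closed_subgroup H"
  shows "right_coset H x = right_coset H y \<longleftrightarrow> x - y \<in> H"
proof
  assume "right_coset H x = right_coset H y"
  moreover have "x \<in> right_coset H x"
    using assms unfolding right_coset_def closed_subgroup_def by (intro image_eqI[of _ _ 0]) simp_all
  ultimately have "x \<in> right_coset H y" by simp
  then show "x - y \<in> H" unfolding right_coset_def by (elim imageE) simp
next
  assume xy: "x - y \<in> H"
  have "right_coset H a \<subseteq> right_coset H b" if "a - b \<in> H" for a b
  proof
    fix z assume "z \<in> right_coset H a"
    then obtain h where "h \<in> H" "z = h + a" by (auto simp: right_coset_def)
    moreover from this have "h + (a - b) \<in> H" using assms that unfolding closed_subgroup_def by blast
    moreover have "h + a = h + (a - b) + b" by (simp add: add.assoc)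
    ultimately show "z \<in> right_coset H b"
      unfolding right_coset_def by (intro image_eqI[of _ _ "h + (a - b)"]) simp_all
  qed
  moreover have "y - x \<in> H"

  proof -
    have "- (x - y) \<in> H" using assms xy unfolding closed_subgroup_def by blast
    then show ?thesis by simp
  qed
  ultimately show "right_coset H x = right_coset H y" using xy by (intro equalityI)
qed

text \<open>\<open>act g P\<close> meets \<open>H\<close> exactly when some \<open>p\<close> in
  \<open>P\<close> has \<open>p - g\<close> in \<open>H\<close>, that is, lies in the coset of
  \<open>g\<close>. Membership in the hull is automatic by its invariance.\<close>

lemma return_set_hull_transversal:
  fixes H P\<^sub>o :: "'a::{topological_group_add, t2_space} set"
  assumes H: "closed_subgroup H" and P: "P \<in> orbit_hull P\<^sub>o"
  shows "return_set H (hull_transversal H P\<^sub>o) P = right_coset H ` P"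
proof (intro equalityI subsetI)
  fix q assume "q \<in> return_set H (hull_transversal H P\<^sub>o) P"
  then obtain g where g: "q = right_coset H g" "act g P \<inter> H \<noteq> {}"
    by (auto simp: return_set_def hull_transversal_def)
  then obtain p where p: "p \<in> P" "p - g \<in> H" by (auto simp: act_def)
  then have "q = right_coset H p" using g right_coset_eq_iff[OF H, of p g] by simp
  then show "q \<in> right_coset H ` P" using p by blast
next
  fix q assume "q \<in> right_coset H ` P"
  then obtain p where p: "q = right_coset H p" "p \<in> P" by blast
  then have "0 \<in> act p P \<inter> H" using H by (simp add: act_eq closed_subgroup_def)
  then have "act p P \<in> hull_transversal H P\<^sub>o"
    using act_orbit_hull[OF P] by (auto simp: hull_transversal_def)
  then show "q \<in> return_set H (hull_transversal H P\<^sub>o) P" using p by (auto simp: return_set_def)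
qed

lemma open_vimage_right_coset_image:
  fixes H U :: "'a::topological_group_add set"
  assumes H: "closed_subgroup H" and "open U"
  shows "open (right_coset H -` right_coset H ` U)"
proof -
  have "right_coset H -` right_coset H ` U = (\<Union>h\<in>H. {x. h + x \<in> U})"
  proof (intro equalityI subsetI)
    fix x assume "x \<in> right_coset H -` right_coset H ` U"
    then obtain u where u: "u \<in> U" "right_coset H x = right_coset H u" by (elim vimageE imageE) simp
    from u(2)[symmetric] have "u - x \<in> H" unfolding right_coset_eq_iff[OF H] .
    with u(1)
    show "x \<in> (\<Union>h\<in>H. {x. h + x \<in> U})" by (intro UN_I[of "u - x"]) auto
  next
    fix x assume "x \<in> (\<Union>h\<in>H. {x. h + x \<in> U})"
    then obtain h where "h \<in> H" "h + x \<in> U" by blast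
    moreover from this have "right_coset H (h + x) = right_coset H x" by (simp add: right_coset_eq_iff[OF H])
    ultimately show "x \<in> right_coset H -` right_coset H ` U" by (intro vimageI2 image_eqI[of _ _ "h + x"]) simp_all
  qed
  then show ?thesis using open_vimage_add_left[OF \<open>open U\<close>] by auto
qed

lemma openin_right_coset_image:
  fixes H U :: "'a::topological_group_add set"
  assumes "closed_subgroup H" "open U"
  shows "openin (right_coset_space H) (right_coset H ` U)"
  using open_vimage_right_coset_image[OF assms] by (auto simp: openin_right_coset_space)

lemma Hausdorff_right_coset_space:
  fixes H :: "'a::topological_group_add set"
  assumes H: "closed_subgroup H" shows "Hausdorff_space (right_coset_space H)"
  unfolding Hausdorff_space_def topspace_right_coset_space
proof (intro allI impI)
  fix a b assume "a \<in> range (right_coset H) \<and> b \<in> range (right_coset H) \<and> a \<noteq> b"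
  then obtain x y where xy: "a = right_coset H x" "b = right_coset H y" "a \<noteq> b" by (elim conjE rangeE)
  then have xy: "a = right_coset H x" "b = right_coset H y" "x - y \<notin> H"
    by (simp_all add: right_coset_eq_iff[OF H])
  have "open ((\<lambda>z. fst z - snd z) -` (- H))"
    using H by (intro open_vimage continuous_intros) (auto simp: closed_subgroup_def)
  moreover have "(x, y) \<in> (\<lambda>z. fst z - snd z) -` (- H)" using xy by simp
  ultimately obtain U V where UV: "open U" "open V" "(x, y) \<in> U \<times> V"
      "U \<times> V \<subseteq> (\<lambda>z. fst z - snd z) -` (- H)"
    by (rule open_prod_elim)
  have "right_coset H u \<noteq> right_coset H v" if "u \<in> U" "v \<in> V" for u v
    using subsetD[OF UV(4), of "(u, v)"] that by (simp add: right_coset_eq_iff[OF H])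
  then have "disjnt (right_coset H ` U) (right_coset H ` V)" by (auto simp: disjnt_def)
  then show "\<exists>U V. openin (right_coset_space H) U \<and> openin (right_coset_space H) V \<and> a \<in> U \<and> b \<in> V \<and> disjnt U V"
    using UV xy openin_right_coset_image[OF H]
    by (intro exI[of _ "right_coset H ` U"] exI[of _ "right_coset H ` V"]) auto
qed

text \<open>The quotient map is open, so images of relatively compact open sets cover
  \<open>L\<close>; finitely many suffice, and compact sets containing them can be united.\<close>

lemma compactin_right_coset_space_lift:
  fixes H :: "'a::topological_group_add set"
  assumes lc: "locally compact (UNIV :: 'a set)" and H: "closed_subgroup H"
    and L: "compactin (right_coset_space H) L"
  obtains T where "compact T" "L \<subseteq> right_coset H ` T"
proof -
  define \<F> where "\<F> = {U :: 'a set. open U \<and> (\<exists>K. compact K \<and> U \<subseteq> K)}"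
  have cov: "L \<subseteq> \<Union>((`) (right_coset H) ` \<F>)"
  proof
    fix q assume "q \<in> L"
    then obtain x where x: "q = right_coset H x"
      using compactin_subset_topspace[OF L] by (auto simp: topspace_right_coset_space)
    obtain U K where "open U" "compact K" "x \<in> U" "U \<subseteq> K" "K \<subseteq> UNIV"
      by (rule compact_neighbourhood[OF lc open_UNIV UNIV_I])
    then have "U \<in> \<F>" "x \<in> U" by (auto simp: \<F>_def)
    then show "q \<in> \<Union>((`) (right_coset H) ` \<F>)" using x by blast
  qed
  have "\<forall>W\<in>(`) (right_coset H) ` \<F>. openin (right_coset_space H) W"
    using openin_right_coset_image[OF H] by (auto simp: \<F>_def)
  then have "\<exists>\<W>. finite \<W> \<and> \<W> \<subseteq> (`) (right_coset H) ` \<F> \<and> L \<subseteq> \<Union>\<W>"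
    using L[unfolded compactin_def, THEN conjunct2, rule_format, of "(`) (right_coset H) ` \<F>"] cov
    by simp
  then obtain \<W> where W: "finite \<W>" "\<W> \<subseteq> (`) (right_coset H) ` \<F>" "L \<subseteq> \<Union>\<W>"
    by (elim exE conjE)
  from finite_subset_image[OF W(1,2)]
  obtain \<F>' where F: "\<F>' \<subseteq> \<F>" "finite \<F>'" "\<W> = (`) (right_coset H) ` \<F>'"
    by (elim exE conjE)
  define k where "k U = (SOME K. compact K \<and> U \<subseteq> K)" for U :: "'a set"
  have k: "compact (k U) \<and> U \<subseteq> k U" if "U \<in> \<F>'" for U
    unfolding k_def by (rule someI_ex) (use subsetD[OF F(1) that] in \<open>simp add: \<F>_def\<close>)
  show thesis
  proof
    show "compact (\<Union>U\<in>\<F>'. k U)" using F(2) k by (intro compact_UN) auto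
    show "L \<subseteq> right_coset H ` (\<Union>U\<in>\<F>'. k U)"
    proof
      fix q assume "q \<in> L"
      then obtain U where U: "U \<in> \<F>'" "q \<in> right_coset H ` U" using W(3) unfolding F(3) by blast
      then show "q \<in> right_coset H ` (\<Union>U\<in>\<F>'. k U)" using k[OF U(1)] by blast
    qed
  qed
qed

text \<open>The preimage of \<open>L\<close> is closed and that of a basic open set is a countable
  union of compact sets. So hitting both with one point of \<open>P\<close> is a countable union of
  events of hitting a compact set.\<close>

lemma count_cosets_measurable:
  fixes H P\<^sub>o :: "'a::{topological_group_add, t2_space, second_countable_topology} set"
  assumes lc: "locally compact (UNIV :: 'a set)" and H: "closed_subgroup H"
    and inv: "invariant_hull_measure P\<^sub>o \<mu>" and L: "compactin (right_coset_space H) L"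
  shows "(\<lambda>P. emeasure (count_space UNIV) (right_coset H ` P \<inter> L)) \<in> borel_measurable \<mu>"
proof -
  let ?\<pi> = "right_coset H"
  obtain \<D> :: "'a set set" where D: "countable \<D>" "topological_basis \<D>" using ex_countable_basis by blast
  have cL: "closed (?\<pi> -` L)"
  proof -
    have "closedin (right_coset_space H) L"
      by (rule compactin_imp_closedin[OF Hausdorff_right_coset_space[OF H] L])
    then have "open (?\<pi> -` (range ?\<pi> - L))"
      by (simp add: closedin_def topspace_right_coset_space openin_right_coset_space)
    moreover have "?\<pi> -` (range ?\<pi> - L) = - (?\<pi> -` L)" by blast
    ultimately show ?thesis by (simp add: closed_def)
  qed
  show ?thesis
  proof (rule count_measurable[OF Hausdorff_right_coset_space[OF H], where \<D>="(`) ?\<pi> ` \<D>"])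
    show "?\<pi> ` P \<inter> L \<subseteq> topspace (right_coset_space H)" for P
      by (auto simp: topspace_right_coset_space)
    show "countable ((`) ?\<pi> ` \<D>)" using D by simp
    show "\<exists>D\<in>(`) ?\<pi> ` \<D>. q \<in> D \<and> D \<subseteq> U" if U: "openin (right_coset_space H) U" "q \<in> U" for U q
    proof -
      obtain x where x: "q = ?\<pi> x" using U by (auto simp: openin_right_coset_space)
      have o: "open (?\<pi> -` U)" using U(1) by (simp add: openin_right_coset_space)
      have "x \<in> ?\<pi> -` U" using U(2) x by simp
      from topological_basisE[OF D(2) o this] obtain B where "B \<in> \<D>" "x \<in> B" "B \<subseteq> ?\<pi> -` U" .
      then show ?thesis using x by (intro bexI[of _ "?\<pi> ` B"]) auto
    qed
    fix E assume "E \<in> (`) ?\<pi> ` \<D>"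
    then obtain B where B: "B \<in> \<D>" "E = ?\<pi> ` B" by blast
    have "open (?\<pi> -` E)"
      unfolding B(2) by (rule open_vimage_right_coset_image[OF H topological_basis_open[OF D(2) B(1)]])
    then obtain \<K> where K: "countable \<K>" "\<And>K. K \<in> \<K> \<Longrightarrow> compact K" "\<Union>\<K> = ?\<pi> -` E"
      by (rule open_sigma_compact[OF lc]) blast
    have "?\<pi> ` P \<inter> L \<inter> E \<noteq> {} \<longleftrightarrow> P \<inter> (?\<pi> -` L \<inter> \<Union>\<K>) \<noteq> {}" for P
      unfolding K(3) by blast
    then have "{P\<in>space \<mu>. ?\<pi> ` P \<inter> L \<inter> E \<noteq> {}} = (\<Union>K\<in>\<K>. {P\<in>space \<mu>. P \<inter> (?\<pi> -` L \<inter> K) \<noteq> {}})"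
      by auto
    also have "\<dots> \<in> sets \<mu>"
      using K(2) cL by (intro sets.countable_UN''[OF K(1)] hit_compact_sets[OF inv] closed_Int_compact)
    finally show "{P\<in>space \<mu>. ?\<pi> ` P \<inter> L \<inter> E \<noteq> {}} \<in> sets \<mu>" .
  qed
qed

subsection \<open>Integrability\<close>

lemma unimodular_bi_invariant_measure:
  assumes lc: "locally compact (UNIV :: 'a::{topological_group_add, t2_space, second_countable_topology} set)"
    and uni: "unimodular (UNIV :: 'a::{topological_group_add, t2_space, second_countable_topology} set)"
  obtains m :: "'a::{topological_group_add, t2_space, second_countable_topology} measure" and B where "sets m = sets borel" "sigma_finite_measure m"
    "\<And>g. distr m borel (\<lambda>x. g + x) = m" "\<And>g. distr m borel (\<lambda>x. x + g) = m"
    "B \<in> sets borel" "0 < emeasure m B" "emeasure m B < \<infinity>"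
proof -
  obtain m0 where m0: "left_haar_measure (UNIV :: 'a set) m0" "right_invariant UNIV m0"
    using uni unfolding unimodular_def by blast
  have cs: "closed_subgroup (UNIV :: 'a set)" by (simp add: closed_subgroup_def)
  obtain m where m: "sets m = sets borel" "\<And>C. compact C \<Longrightarrow> emeasure m C < \<infinity>"
    "\<And>A. A \<in> sets m0 \<Longrightarrow> A \<in> sets borel \<and> A \<subseteq> UNIV \<and> emeasure m A = emeasure m0 A"
    "\<And>k A. k \<in> UNIV \<Longrightarrow> A \<in> sets borel \<Longrightarrow> emeasure m {x. k + x \<in> A} = emeasure m A"
    "emeasure m (- UNIV) = 0" "emeasure m UNIV \<noteq> 0"
    by (rule haar_measure_extension[OF cs m0(1)]) blast
  have sm0: "sets m0 = sets borel"
    using m0(1) by (simp add: left_haar_measure_def sets_restrict_space)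
  have tr: "(\<lambda>x. g + x) \<in> borel_measurable m" "(\<lambda>x. x + g) \<in> borel_measurable m" for g
    using m(1) by (simp_all add: borel_measurable_continuous_onI continuous_intros)
  have sp: "space m = UNIV" using sets_eq_imp_space_eq[OF m(1)] by simp
  have 1: "distr m borel (\<lambda>x. g + x) = m" for g
  proof (rule measure_eqI)
    fix A assume "A \<in> sets (distr m borel (\<lambda>x. g + x))"
    then show "emeasure (distr m borel (\<lambda>x. g + x)) A = emeasure m A"
      using m(4)[of g A] by (simp add: emeasure_distr[OF tr(1)] sp vimage_def)
  qed (simp add: m(1))
  have 2: "distr m borel (\<lambda>x. x + g) = m" for g
  proof (rule measure_eqI)
    fix A assume "A \<in> sets (distr m borel (\<lambda>x. x + g))"
    then have A: "A \<in> sets borel" by simp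
    have "{x. x + g \<in> A} = (\<lambda>x. x + - g) ` A" by (auto intro!: image_eqI[of _ _ "_ + g"])
    moreover have "{x. x + g \<in> A} \<in> sets borel"
      using measurable_sets[OF tr(2) A] by (simp add: vimage_def sp m(1))
    ultimately have "emeasure m {x. x + g \<in> A} = emeasure m0 ((\<lambda>x. x + - g) ` A)"
      using m(3) sm0 by simp
    also have "\<dots> = emeasure m0 A"
      using m0(2)[unfolded right_invariant_def sm0, rule_format, OF UNIV_I A] .
    also have "\<dots> = emeasure m A" using A m(3)[of A] by (simp add: sm0)
    finally show "emeasure (distr m borel (\<lambda>x. x + g)) A = emeasure m A"
      using A by (simp add: emeasure_distr[OF tr(2)] sp vimage_def)
  qed (simp add: m(1))
  obtain U K :: "'a set" where UK: "open U" "compact K" "0 \<in> U" "U \<subseteq> K" "K \<subseteq> UNIV"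
    by (rule compact_neighbourhood[OF lc open_UNIV UNIV_I])
  have pos: "0 < emeasure m U"
    by (rule left_invariant_open_pos[OF m(1) m(5) m(6) _ cs UK(1,3)]) (rule m(4))
  have fin: "emeasure m U < \<infinity>"
    using emeasure_mono[OF UK(4), of m] m(1) m(2)[OF UK(2)] UK(2)
    by (simp add: borel_closed compact_imp_closed le_less_trans)
  show thesis
    by (rule that[OF m(1) sigma_finite_of_finite_on_compact[OF lc m(1) m(2)] 1 2 _ pos fin])
      (use UK in auto)
qed

text \<open>One representative \<open>p q\<close> in \<open>P\<close> is chosen for each coset
  \<open>q\<close>. Adding elements of \<Gamma> keeps the coset, so \<open>(q, l)\<close> is
  recovered from \<open>l + p q\<close>, and the sums over different cosets run over disjoint
  subsets of \<Gamma> + P.\<close>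

lemma nn_integral_cosets_le:
  fixes H P :: "'a::topological_group_add set" and \<phi> :: "'a \<Rightarrow> ennreal"
  assumes H: "closed_subgroup H" and \<Gamma>: "\<Gamma> \<subseteq> H"
    and c: "\<And>p. p \<in> P \<Longrightarrow> right_coset H p \<in> L \<Longrightarrow> c \<le> (\<integral>\<^sup>+l. \<phi> (l + p) \<partial>count_space \<Gamma>)"
  shows "c * emeasure (count_space UNIV) (right_coset H ` P \<inter> L)
    \<le> (\<integral>\<^sup>+y. \<phi> y * indicator (\<Gamma> + P) y \<partial>count_space UNIV)"
proof -
  let ?\<pi> = "right_coset H"
  define Q where "Q = ?\<pi> ` P \<inter> L"
  define p where "p q = (SOME p. p \<in> P \<and> ?\<pi> p = q)" for q
  have p: "p q \<in> P \<and> ?\<pi> (p q) = q" if "q \<in> Q" for q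
    unfolding p_def by (rule someI_ex) (use that in \<open>auto simp: Q_def\<close>)
  have \<pi>: "?\<pi> (l + p q) = q" if "l \<in> \<Gamma>" "q \<in> Q" for l q
    using p[OF that(2)] that(1) \<Gamma> right_coset_eq_iff[OF H, of "l + p q" "p q"] by auto
  define f where "f = (\<lambda>(q, l). l + p q)"
  have inj: "inj_on f (Q \<times> \<Gamma>)"
  proof (rule inj_onI)
    fix x y assume xy: "x \<in> Q \<times> \<Gamma>" "y \<in> Q \<times> \<Gamma>" "f x = f y"
    have "fst x = fst y"
      using \<pi>[of "snd x" "fst x"] \<pi>[of "snd y" "fst y"] xy by (auto simp: f_def case_prod_unfold)
    then show "x = y" using xy by (auto simp: f_def case_prod_unfold prod_eq_iff)
  qed
  have sub: "f ` (Q \<times> \<Gamma>) \<subseteq> \<Gamma> + P" using p by (auto simp: f_def set_plus_def)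
  have "c * emeasure (count_space UNIV) Q = (\<integral>\<^sup>+q. c * indicator Q q \<partial>count_space UNIV)"
    by (simp add: nn_integral_cmult)
  also have "\<dots> \<le> (\<integral>\<^sup>+q. \<integral>\<^sup>+l. \<phi> (l + p q) * indicator (Q \<times> \<Gamma>) (q, l) \<partial>count_space UNIV \<partial>count_space UNIV)"
  proof (rule nn_integral_mono)
    fix q
    show "c * indicator Q q \<le> (\<integral>\<^sup>+l. \<phi> (l + p q) * indicator (Q \<times> \<Gamma>) (q, l) \<partial>count_space UNIV)"
    proof (cases "q \<in> Q")
      case True
      have "c \<le> (\<integral>\<^sup>+l. \<phi> (l + p q) \<partial>count_space \<Gamma>)" using c p[OF True] True by (auto simp: Q_def)
      also have "\<dots> = (\<integral>\<^sup>+l. \<phi> (l + p q) * indicator (Q \<times> \<Gamma>) (q, l) \<partial>count_space UNIV)"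
        using True by (simp add: nn_integral_count_space_indicator indicator_times)
      finally show ?thesis using True by simp
    qed simp
  qed
  also have "\<dots> = (\<integral>\<^sup>+x. \<phi> (f x) * indicator (Q \<times> \<Gamma>) x \<partial>count_space UNIV)"
    by (subst nn_integral_fst_count_space[symmetric]) (simp add: f_def)
  also have "\<dots> = (\<integral>\<^sup>+x. \<phi> (f x) \<partial>count_space (Q \<times> \<Gamma>))"
    by (simp add: nn_integral_count_space_indicator)
  also have "\<dots> = (\<integral>\<^sup>+y. \<phi> y \<partial>count_space (f ` (Q \<times> \<Gamma>)))"
    by (rule nn_integral_bij_count_space[OF inj_on_imp_bij_betw[OF inj]])
  also have "\<dots> = (\<integral>\<^sup>+y. \<phi> y * indicator (f ` (Q \<times> \<Gamma>)) y \<partial>count_space UNIV)"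
    by (simp add: nn_integral_count_space_indicator)
  also have "\<dots> \<le> (\<integral>\<^sup>+y. \<phi> y * indicator (\<Gamma> + P) y \<partial>count_space UNIV)"
    using sub by (intro nn_integral_mono mult_left_mono) (auto simp: indicator_def)
  finally show ?thesis by (simp add: Q_def)
qed

text \<open>Averaging over \<open>T\<close> with a Haar measure of \<open>H\<close> avoids the choice of a Borel section of
  \<open>G \<rightarrow> H\G\<close>.\<close>

lemma coset_weight_ge:
  fixes mH :: "'a::{topological_group_add, t2_space, second_countable_topology} measure"
  assumes H: "closed_subgroup H" and mH: "sets mH = sets borel" "emeasure mH (- H) = 0"
    and linv: "\<And>k A. k \<in> H \<Longrightarrow> A \<in> sets borel \<Longrightarrow> emeasure mH {x. k + x \<in> A} = emeasure mH A"
    and \<Gamma>: "countable \<Gamma>" "\<Gamma> \<subseteq> H" "\<And>x. x \<in> \<Gamma> \<Longrightarrow> - x \<in> \<Gamma>" "H = \<Gamma> + F"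
    and F: "F \<in> sets borel" and K0: "compact K0" and T: "T = K0 + T0" "T \<in> sets borel"
    and p: "right_coset H p \<in> right_coset H ` T0"
  shows "emeasure mH {f. - f \<in> K0} \<le>
    (\<integral>\<^sup>+l. (\<integral>\<^sup>+f. indicator F f * indicator T (- f + (l + p)) \<partial>mH) \<partial>count_space \<Gamma>)"
proof -
  note [measurable] = borel_measurable_group_add borel_measurable_group_uminus F T(2)
  note [measurable_cong] = mH(1)
  have K0b[measurable]: "K0 \<in> sets borel" using K0 by (simp add: borel_closed compact_imp_closed)
  have Hb[measurable]: "H \<in> sets borel" using H by (simp add: closed_subgroup_def borel_closed)
  have sp: "space mH = UNIV" using sets_eq_imp_space_eq[OF mH(1)] by simp
  obtain k0 where k0: "k0 \<in> T0" "right_coset H p = right_coset H k0" using p by blast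
  have pk: "p - k0 \<in> H" using k0(2) right_coset_eq_iff[OF H] by simp
  let ?A = "{f. - f \<in> K0}" and ?X = "{f. - f + p \<in> T}"
  have Ab: "?A \<in> sets borel" by measurable
  have Xb: "?X \<in> sets borel" by measurable
  \<comment> \<open>Translation by \<open>p - k0\<close>, an element of \<open>H\<close>, makes the
    lower bound depend on \<open>K0\<close> alone, not on the coset or its representative
    \<open>p\<close>.\<close>
  have "- (p - k0) \<in> H" using pk H unfolding closed_subgroup_def by blast
  from linv[OF this Ab] have "emeasure mH ?A = emeasure mH {x. - (p - k0) + x \<in> ?A}" by (rule sym)
  also have "\<dots> \<le> emeasure mH ?X"
  proof (rule emeasure_mono)
    show "{x. - (p - k0) + x \<in> ?A} \<subseteq> ?X"
    proof
      fix x assume "x \<in> {x. - (p - k0) + x \<in> ?A}"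
      then have "- (- (p - k0) + x) \<in> K0" by blast
      then have "- (- (p - k0) + x) + k0 \<in> T" using k0(1) by (auto simp: T(1) set_plus_def)
      also have "- (- (p - k0) + x) + k0 = - x + p" by (simp add: minus_add add.assoc del: minus_diff_eq)
      finally show "x \<in> ?X" by simp
    qed
  qed (use Xb mH in simp)
  \<comment> \<open>Restricting to \<open>H\<close> costs no mass and is required, since only
    elements of \<open>H\<close> decompose along \<open>\<Gamma> + F\<close>.\<close>
  also have "\<dots> \<le> emeasure mH ((?X \<inter> H) \<union> (- H))" using Xb mH(1) by (intro emeasure_mono) auto
  also have "\<dots> \<le> emeasure mH (?X \<inter> H) + emeasure mH (- H)"
    using Xb mH(1) by (intro emeasure_subadditive) auto
  also have "\<dots> = (\<integral>\<^sup>+f. indicator (?X \<inter> H) f \<partial>mH)" using mH Xb by simp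
  \<comment> \<open>For \<open>f = l + g\<close> with \<open>g\<close> in \<open>F\<close>, symmetry
    of \<Gamma> supplies the index \<open>- l\<close>, and \<open>- l + f\<close> lies in
    \<open>F\<close>. So at least one term of the sum equals 1.\<close>
  also have "\<dots> \<le> (\<integral>\<^sup>+f. (\<integral>\<^sup>+l. indicator F (l + f) * indicator T (- f + p) \<partial>count_space \<Gamma>) \<partial>mH)"
  proof (rule nn_integral_mono)
    fix f
    show "indicator (?X \<inter> H) f \<le> (\<integral>\<^sup>+l. indicator F (l + f) * indicator T (- f + p) \<partial>count_space \<Gamma> :: ennreal)"
    proof (cases "f \<in> ?X \<inter> H")
      case True
      then obtain l g where l: "l \<in> \<Gamma>" "g \<in> F" "f = l + g" using \<Gamma>(4) by (auto simp: set_plus_def)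
      have "(1 :: ennreal) = indicator F (- l + f) * indicator T (- f + p)"
        using True l by (simp add: add.assoc[symmetric])
      also have "\<dots> \<le> (\<integral>\<^sup>+l. indicator F (l + f) * indicator T (- f + p) \<partial>count_space \<Gamma>)"
        by (rule nn_integral_ge_point) (use \<Gamma>(3) l in simp)
      finally show ?thesis using True by simp
    qed simp
  qed
  also have "\<dots> = (\<integral>\<^sup>+l. (\<integral>\<^sup>+f. indicator F (l + f) * indicator T (- f + p) \<partial>mH) \<partial>count_space \<Gamma>)"
    by (rule nn_integral_count_space_nn_integral[OF \<Gamma>(1)]) measurable
  \<comment> \<open>Substituting \<open>l + f\<close> for \<open>f\<close> moves the translation by
    \<open>l\<close> from \<open>F\<close> to \<open>T\<close>; it cancels in
    \<open>- (l + f) + (l + p)\<close>.\<close>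
  also have "\<dots> = (\<integral>\<^sup>+l. (\<integral>\<^sup>+f. indicator F f * indicator T (- f + (l + p)) \<partial>mH) \<partial>count_space \<Gamma>)"
  proof (rule nn_integral_cong)
    fix l assume "l \<in> space (count_space \<Gamma>)"
    then have l: "l \<in> H" using \<Gamma>(2) by auto
    have "distr mH borel (\<lambda>x. l + x) = mH"
    proof (rule measure_eqI)
      fix A assume "A \<in> sets (distr mH borel (\<lambda>x. l + x))"
      moreover have "(\<lambda>x. l + x) \<in> borel_measurable mH" by measurable
      ultimately show "emeasure (distr mH borel (\<lambda>x. l + x)) A = emeasure mH A"
        using linv[OF l, of A] by (simp add: emeasure_distr sp vimage_def)
    qed (simp add: mH)
    then have "(\<integral>\<^sup>+f. indicator F (l + f) * indicator T (- (l + f) + (l + p)) \<partial>mH)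
        = (\<integral>\<^sup>+f. indicator F f * indicator T (- f + (l + p)) \<partial>mH)"
      by (rule nn_integral_invariant) measurable
    moreover have "- (l + f) + (l + p) = - f + p" for f by (simp add: minus_add add.assoc del: add_uminus_conv_diff)
    ultimately show "(\<integral>\<^sup>+f. indicator F (l + f) * indicator T (- f + p) \<partial>mH)
      = (\<integral>\<^sup>+f. indicator F f * indicator T (- f + (l + p)) \<partial>mH)" by simp
  qed
  finally show ?thesis .
qed

lemma (in hull_process) intensity_left_invariant:
  assumes lc: "locally compact (UNIV :: 'a set)" and uni: "unimodular (UNIV :: 'a set)"
    and A: "A \<in> sets borel"
  shows "emeasure intensity {x. g + x \<in> A} = emeasure intensity A"
proof -
  obtain m :: "'a measure" and B where m: "sets m = sets borel" "sigma_finite_measure m"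
    "\<And>g. distr m borel (\<lambda>x. g + x) = m" "\<And>g. distr m borel (\<lambda>x. x + g) = m"
    "B \<in> sets borel" "0 < emeasure m B" "emeasure m B < \<infinity>"
    by (rule unimodular_bi_invariant_measure[OF lc uni]) blast
  show ?thesis
    by (rule right_invariant_imp_left_invariant[OF sets_intensity m(1)
          sigma_finite_of_finite_on_compact[OF lc sets_intensity intensity_compact_finite] m(2)
          intensity_right_invariant m(3-7) A])
qed

lemma (in hull_process) count_cosets_integral_finite:
  assumes lc: "locally compact (UNIV :: 'a set)" and uni: "unimodular (UNIV :: 'a set)"
    and H: "closed_subgroup H" "unimodular H"
    and \<Gamma>: "\<Gamma> \<subseteq> H" "\<And>x. x \<in> \<Gamma> \<Longrightarrow> - x \<in> \<Gamma>" "finite_covolume H \<Gamma>"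
    and L: "compactin (right_coset_space H) L"
  shows "(\<integral>\<^sup>+P. emeasure (count_space UNIV) (right_coset H ` P \<inter> L) \<partial>\<mu>) < \<infinity>"
proof -
  obtain m where m: "left_haar_measure H m" using H(2) unfolding unimodular_def by blast
  obtain mH where mH: "sets mH = sets borel" "\<And>C. compact C \<Longrightarrow> emeasure mH C < \<infinity>"
    "\<And>A. A \<in> sets m \<Longrightarrow> A \<in> sets borel \<and> A \<subseteq> H \<and> emeasure mH A = emeasure m A"
    "\<And>k A. k \<in> H \<Longrightarrow> A \<in> sets borel \<Longrightarrow> emeasure mH {x. k + x \<in> A} = emeasure mH A"
    "emeasure mH (- H) = 0" "emeasure mH UNIV \<noteq> 0"
    by (rule haar_measure_extension[OF H(1) m]) blast
  obtain F where F: "F \<in> sets (restrict_space borel H)" "H = \<Gamma> + F" "emeasure m F < \<infinity>"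
    using \<Gamma>(3) m unfolding finite_covolume_def by blast
  have "F \<in> sets m" using F(1) m by (simp add: left_haar_measure_def)
  then have Fb: "F \<in> sets borel" and Ffin: "emeasure mH F < \<infinity>" using mH(3) F(3) by auto
  obtain U0 K0 :: "'a set" where K0: "open U0" "compact K0" "0 \<in> U0" "U0 \<subseteq> K0" "K0 \<subseteq> UNIV"
    by (rule compact_neighbourhood[OF lc open_UNIV UNIV_I])
  obtain T0 where T0: "compact T0" "L \<subseteq> right_coset H ` T0"
    by (rule compactin_right_coset_space_lift[OF lc H(1) L])
  \<comment> \<open>\<open>T0\<close> contains representatives of the cosets in \<open>L\<close>.
    Thickening it by a neighbourhood of 0 gives every such coset a window of positive Haar measure
    in \<open>H\<close>.\<close>
  define T where "T = K0 + T0"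
  have "T = (\<lambda>z. fst z + snd z) ` (K0 \<times> T0)" by (force simp: T_def set_plus_def)
  then have cT: "compact T"
    using K0(2) T0(1) by (simp add: compact_continuous_image continuous_intros compact_Times)
  then have Tb: "T \<in> sets borel" by (simp add: borel_closed compact_imp_closed)
  note [measurable] = borel_measurable_group_add borel_measurable_group_uminus Fb Tb
  note [measurable_cong] = mH(1)
  define c where "c = emeasure mH {f. - f \<in> K0}"
  have cpos: "0 < c"
  proof -
    have "open ((uminus :: 'a \<Rightarrow> 'a) -` U0)" by (intro open_vimage K0 continuous_intros)
    then have "0 < emeasure mH (uminus -` U0)"
      using K0(3) by (intro left_invariant_open_pos[OF mH(1,5,6) mH(4) H(1)]) simp_all
    also have "\<dots> \<le> c"
    proof -
      have "K0 \<in> sets borel" using K0 by (simp add: borel_closed compact_imp_closed)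
      from measurable_sets[OF borel_measurable_group_uminus this]
      have "{f. - f \<in> K0} \<in> sets mH" by (simp add: vimage_def mH)
      then show ?thesis unfolding c_def using K0(4) by (intro emeasure_mono) auto
    qed
    finally show ?thesis .
  qed
  \<comment> \<open>The Haar measure of those \<open>f\<close> in \<open>F\<close> for which
    \<open>y\<close> lies in \<open>f + T\<close>. Summed over \<Gamma> + p it is at least
    \<open>c\<close>, whatever the coset of \<open>p\<close> in \<open>L\<close>.\<close>
  define \<phi> where "\<phi> y = (\<integral>\<^sup>+f. indicator F f * indicator T (- f + y) \<partial>mH)" for y
  interpret mH: sigma_finite_measure mH by (rule sigma_finite_of_finite_on_compact[OF lc mH(1,2)])
  interpret \<nu>: sigma_finite_measure intensity
    by (rule sigma_finite_of_finite_on_compact[OF lc sets_intensity intensity_compact_finite])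
  interpret pair_sigma_finite mH intensity ..
  have \<phi>b: "\<phi> \<in> borel_measurable borel" unfolding \<phi>_def by measurable
  have "(\<integral>\<^sup>+y. \<phi> y \<partial>intensity) = (\<integral>\<^sup>+f. \<integral>\<^sup>+y. indicator F f * indicator T (- f + y) \<partial>intensity \<partial>mH)"
    unfolding \<phi>_def by (rule Fubini') measurable
  \<comment> \<open>Left invariance of the intensity gives each left translate \<open>f + T\<close>
    the mass of \<open>T\<close>, so the double integral factors even when \<open>F\<close> is
    unbounded.\<close>
  also have "\<dots> = (\<integral>\<^sup>+f. indicator F f * emeasure intensity T \<partial>mH)"
  proof (rule nn_integral_cong)
    fix f
    have "{y. - f + y \<in> T} \<in> sets borel" by measurable
    then have "(\<integral>\<^sup>+y. indicator {y. - f + y \<in> T} y \<partial>intensity) = emeasure intensity T"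
      using intensity_left_invariant[OF lc uni Tb, of "- f"] by simp
    moreover have "indicator {y. - f + y \<in> T} y = (indicator T (- f + y) :: ennreal)" for y
      by (simp add: indicator_def)
    ultimately show "(\<integral>\<^sup>+y. indicator F f * indicator T (- f + y) \<partial>intensity) = indicator F f * emeasure intensity T"
      by (simp add: nn_integral_cmult)
  qed
  also have "\<dots> = emeasure mH F * emeasure intensity T" using Fb mH(1) by (simp add: nn_integral_multc)
  also have "\<dots> < \<infinity>" using Ffin intensity_compact_finite[OF cT] by (simp add: ennreal_mult_less_top)
  finally have fin: "(\<integral>\<^sup>+y. \<phi> y \<partial>intensity) < \<infinity>" .
  let ?N = "\<lambda>P. emeasure (count_space UNIV) (right_coset H ` P \<inter> L)"
  have "c * (\<integral>\<^sup>+P. ?N P \<partial>\<mu>) = (\<integral>\<^sup>+P. c * ?N P \<partial>\<mu>)"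
    by (rule nn_integral_cmult[symmetric, OF count_cosets_measurable[OF lc H(1) inv L]])
  also have "\<dots> \<le> (\<integral>\<^sup>+P. \<integral>\<^sup>+y. \<phi> y * indicator (\<Gamma> + P) y \<partial>count_space UNIV \<partial>\<mu>)"
  proof (rule nn_integral_mono, rule nn_integral_cosets_le[OF H(1) \<Gamma>(1)])
    fix p assume "right_coset H p \<in> L"
    then have "right_coset H p \<in> right_coset H ` T0" using T0(2) by blast
    then show "c \<le> (\<integral>\<^sup>+l. \<phi> (l + p) \<partial>count_space \<Gamma>)"
      unfolding c_def \<phi>_def
      by (intro coset_weight_ge[OF H(1) mH(1,5) mH(4) countable \<Gamma>(1) \<Gamma>(2) F(2) Fb K0(2) T_def Tb])
  qed
  also have "\<dots> = (\<integral>\<^sup>+y. \<phi> y \<partial>intensity)" using nn_integral_intensity[OF \<phi>b] by simp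
  finally have "c * (\<integral>\<^sup>+P. ?N P \<partial>\<mu>) < \<infinity>" using fin by (rule le_less_trans)
  then show ?thesis using cpos by (auto simp: ennreal_mult_less_top)
qed

theorem theorem5:
  fixes H \<Lambda> P\<^sub>o :: "'a::{topological_group_add, t2_space, second_countable_topology} set"
    and \<mu> :: "'a set measure"
  assumes "locally compact (UNIV :: 'a set)"
    and "unimodular (UNIV :: 'a set)"
    and "closed_subgroup H"
    and "unimodular H"
    and "compatible_pair H \<Lambda>"
    and "P\<^sub>o \<subseteq> \<Lambda>"
    and "measured P\<^sub>o"
    and "invariant_hull_measure P\<^sub>o \<mu>"
  shows "integrable_transverse_system H (hull_transversal H P\<^sub>o) \<mu>"
proof -
  have lat: "approximate_lattice UNIV \<Lambda>" "approximate_lattice H (\<Lambda> \<inter> H)"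
    using assms(5) by (simp_all add: compatible_pair_def)
  then have \<Lambda>: "discrete \<Lambda>" "approximate_subgroup UNIV \<Lambda>"
    and \<Lambda>H: "approximate_subgroup H (\<Lambda> \<inter> H)" "finite_covolume H (\<Lambda> \<inter> H)"
    by (simp_all add: approximate_lattice_def)
  have sym: "- x \<in> \<Lambda>" if "x \<in> \<Lambda>" for x using \<Lambda>(2) that by (simp add: approximate_subgroup_def)
  have symH: "- x \<in> \<Lambda> \<inter> H" if "x \<in> \<Lambda> \<inter> H" for x
    using \<Lambda>H(1) that unfolding approximate_subgroup_def by blast
  obtain V where V: "open V" "0 \<in> V" "closure (\<Lambda> + \<Lambda> + (\<Lambda> + \<Lambda>)) \<inter> V \<subseteq> {0}"
    by (rule discrete_approximate_subgroup_isolated[OF \<Lambda>]) blast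
  \<comment> \<open>Continuity of subtraction at (0, 0) yields a neighbourhood of 0 whose
    differences lie in \<open>V\<close>; it serves as the tile shape.\<close>
  have "open ((\<lambda>z. fst z - snd z) -` V)" by (intro open_vimage V continuous_intros)
  moreover have "(0, 0) \<in> (\<lambda>z. fst z - snd z) -` V" using V by simp
  ultimately obtain A B where AB: "open A" "open B" "(0, 0) \<in> A \<times> B" 
      "A \<times> B \<subseteq> (\<lambda>z. fst z - snd z) -` V"
    by (rule open_prod_elim)
  interpret hull_process P\<^sub>o \<mu> "\<Lambda> \<inter> H" "A \<inter> B"
  proof
    show "invariant_hull_measure P\<^sub>o \<mu>" by fact
    show "countable (\<Lambda> \<inter> H)" using countable_discrete[OF \<Lambda>(1)] by (rule countable_subset[rotated]) simp
    show "open (A \<inter> B)" "0 \<in> A \<inter> B" using AB by auto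
    fix P x y g
    assume P: "P \<in> orbit_hull P\<^sub>o" and xy: "x \<in> \<Lambda> \<inter> H + P" "y \<in> \<Lambda> \<inter> H + P"
      and g: "x - g \<in> A \<inter> B" "y - g \<in> A \<inter> B"
    obtain l p where l: "l \<in> \<Lambda>" "p \<in> P" "x = l + p" using xy(1) by (auto simp: set_plus_def)
    obtain k q where k: "k \<in> \<Lambda>" "q \<in> P" "y = k + q" using xy(2) by (auto simp: set_plus_def)
    have "{a - b | a b. a \<in> P\<^sub>o \<and> b \<in> P\<^sub>o} \<subseteq> \<Lambda> + \<Lambda>"
    proof
      fix z assume "z \<in> {a - b | a b. a \<in> P\<^sub>o \<and> b \<in> P\<^sub>o}"
      then obtain a b where "z = a + - b" "a \<in> P\<^sub>o" "b \<in> P\<^sub>o" by auto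
      then show "z \<in> \<Lambda> + \<Lambda>" using assms(6) sym by (auto intro!: set_plus_intro simp del: add_uminus_conv_diff)
    qed
    then have "p - q \<in> closure (\<Lambda> + \<Lambda>)"
      using orbit_hull_differences[OF P l(2) k(2)] closure_mono by blast
    moreover have "l \<in> closure \<Lambda>" "- k \<in> closure \<Lambda>" 
      using l k sym by (auto intro: closure_subset[THEN subsetD])
    \<comment> \<open>The difference \<open>x - y\<close> is rewritten as
      \<open>l + (p - q) - k\<close>: two summands of \<Lambda> come from \<open>p - q\<close>, one
      each from \<open>l\<close> and \<open>k\<close>.\<close>
    ultimately have "l + ((p - q) + - k) \<in> closure \<Lambda> + (closure (\<Lambda> + \<Lambda>) + closure \<Lambda>)"
      by (intro set_plus_intro)
    also have "\<dots> \<subseteq> closure (\<Lambda> + (\<Lambda> + \<Lambda> + \<Lambda>))"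
      by (rule order_trans[OF set_plus_mono2[OF order_refl closure_add_subset] closure_add_subset])
    also have "l + ((p - q) + - k) = x - y"
      by (simp add: l k diff_add_eq_diff_diff_swap add_diff_eq)
    finally have "x - y \<in> closure (\<Lambda> + \<Lambda> + (\<Lambda> + \<Lambda>))" by (simp add: add.assoc)
    \<comment> \<open>The centre \<open>g\<close> of the tile cancels from the difference, so
      isolation of 0 alone separates points in every tile.\<close>
    moreover have "x - y = (x - g) - (y - g)" by (simp add: diff_diff_eq2)
    then have "x - y \<in> V" using subsetD[OF AB(4), of "(x - g, y - g)"] g by simp
    ultimately show "x = y" using V(3) by auto
  qed
  have eq: "emeasure (count_space UNIV) (return_set H (hull_transversal H P\<^sub>o) P \<inter> L)
      = emeasure (count_space UNIV) (right_coset H ` P \<inter> L)" if "P \<in> space \<mu>" for P L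
    using that by (simp add: space_hull_measure[OF assms(8)] return_set_hull_transversal[OF assms(3)])
  show ?thesis
    unfolding integrable_transverse_system_def
  proof (intro allI impI conjI)
    fix L assume L: "compactin (right_coset_space H) L"
    show "(\<lambda>P. emeasure (count_space UNIV) (return_set H (hull_transversal H P\<^sub>o) P \<inter> L)) \<in> borel_measurable \<mu>"
      using count_cosets_measurable[OF assms(1,3,8) L] by (subst measurable_cong[OF eq])
    show "(\<integral>\<^sup>+P. emeasure (count_space UNIV) (return_set H (hull_transversal H P\<^sub>o) P \<inter> L) \<partial>\<mu>) < \<infinity>"
      using count_cosets_integral_finite[OF assms(1-4) _ symH \<Lambda>H(2) L]
      by (subst nn_integral_cong[OF eq]) simp_all
  qed
qed

end
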